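(* Let $f:\mathbb{T}^2\to\mathbb{T}^2$ be an area preserving toral endomorphism of degree at least two. If $f$ is not transitive, then $f$ is homotopic to a linear map (induced by a non-singular $2\times 2$ integer matrix) which has a real eigenvalue of modulus one.
   Context: $\mathbb{T}^2=\mathbb{R}^2/\mathbb{Z}^2$ with Haar (Lebesgue) measure $\lambda$. A toral endomorphism is a local homeomorphism $f:\mathbb{T}^2\to\mathbb{T}^2$ (equivalently a covering map of the torus to itself). It is area preserving if $\lambda(f^{-1}(B))=\lambda(B)$ for every Borel set $B\subset\mathbb{T}^2$. Every endomorphism is homotopic to exactly one map induced by a non-singular integer $2\times2$ matrix $A$ (its action on $\pi_1(\mathbb{T}^2)\cong\mathbb{Z}^2$); the degree of $f$ (number of sheets) is $|\det A|$, the cardinality of every preimage $f^{-1}(x)$. $f$ is transitive if there is $x\in\mathbb{T}^2$ whose forward orbit $\{f^n(x):n\ge 0\}$ is dense in $\mathbb{T}^2$. *)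

theory Defs
  imports "HOL-Analysis.Analysis"
begin

definition torus :: "(complex \<times> complex) set" where
  "torus = {(z, w). cmod z = 1 \<and> cmod w = 1}"

definition torus_proj :: "real \<times> real \<Rightarrow> complex \<times> complex" where
  "torus_proj = (\<lambda>(s, t). (cis (2 * pi * s), cis (2 * pi * t)))"

definition torus_measure :: "(complex \<times> complex) measure" where
  "torus_measure = distr (restrict_space lborel ({0..1} \<times> {0..1}))
                         (restrict_space borel torus) torus_proj"

definition toral_endomorphism :: "(complex \<times> complex \<Rightarrow> complex \<times> complex) \<Rightarrow> bool" where
  "toral_endomorphism f \<longleftrightarrow> f ` torus \<subseteq> torus \<and>
     (\<forall>x\<in>torus. \<exists>U g. openin (top_of_set torus) U \<and> x \<in> U \<and>
                    openin (top_of_set torus) (f ` U) \<and> homeomorphism U (f ` U) f g)"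

definition area_preserving :: "(complex \<times> complex \<Rightarrow> complex \<times> complex) \<Rightarrow> bool" where
  "area_preserving f \<longleftrightarrow> (\<forall>B \<in> sets torus_measure.
      emeasure torus_measure (f -` B \<inter> space torus_measure) = emeasure torus_measure B)"

text \<open>Degree = number of sheets = cardinality of (every) fibre.\<close>
definition toral_degree :: "(complex \<times> complex \<Rightarrow> complex \<times> complex) \<Rightarrow> complex \<times> complex \<Rightarrow> nat" where
  "toral_degree f x = card {y \<in> torus. f y = x}"

definition toral_transitive :: "(complex \<times> complex \<Rightarrow> complex \<times> complex) \<Rightarrow> bool" where
  "toral_transitive f \<longleftrightarrow> (\<exists>x\<in>torus. torus \<subseteq> closure {(f ^^ n) x | n. True})"

text \<open>The linear toral map induced by an integer 2x2 matrix A (acting on column vectors):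
  (z,w) |-> (z^a11 w^a12, z^a21 w^a22).\<close>
definition linear_toral_map :: "int ^ 2 ^ 2 \<Rightarrow> complex \<times> complex \<Rightarrow> complex \<times> complex" where
  "linear_toral_map A = (\<lambda>(z, w).
     (z powi (A $ 1 $ 1) * w powi (A $ 1 $ 2), z powi (A $ 2 $ 1) * w powi (A $ 2 $ 2)))"

definition real_matrix_of_int :: "int ^ 2 ^ 2 \<Rightarrow> real ^ 2 ^ 2" where
  "real_matrix_of_int A = (\<chi> i j. real_of_int (A $ i $ j))"

end

theory Submission
  imports Defs
begin

text \<open>
  A toral endomorphism \<open>f\<close> lifts to a homeomorphism \<open>F\<close> of the plane with
  \<open>F (x + k) = F x + A k\<close> on the integer lattice. If \<open>f\<close> is not transitive, Baire's theorem and
  preservation of area produce two disjoint nonempty open lattice-periodic sets, each equal to its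
  preimage under \<open>F\<close>. By recurrence some component \<open>C\<close> of such a set satisfies
  \<open>F\<^sup>n C = C + j\<close>, and area preservation shows that \<open>F\<^sup>n\<close> permutes the lattice translates of
  \<open>C\<close>. Hence \<open>A\<^sup>n\<close> maps the stabiliser \<open>H\<close> of \<open>C\<close> into itself and induces a surjection of
  the quotient of the lattice by \<open>H\<close>. As \<open>A\<close> is not surjective on the lattice, \<open>H\<close> is
  nontrivial; if it has rank one, then \<open>1\<close> or \<open>-1\<close> is an eigenvalue of \<open>A\<^sup>n\<close> and therefore of
  \<open>A\<close>. If \<open>H\<close> had rank two for both invariant sets, one would contain a horizontally periodic
  curve and the other a vertically periodic one, and these would have to cross.
\<close>

section \<open>Locally injective maps with uniform radii\<close>

text \<open>Passing to the plane trades the many-to-one \<open>f\<close> for a bijection, so that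
  components of an invariant open set go to components; the degree survives in the failure of
  \<open>A\<close> to map the lattice onto itself. This failure acts twice: it rules out a component
  whose lattice translates are all distinct, and it rules out that a power of \<open>A\<close> is
  the identity, as a non-real root of unity as eigenvalue would entail. The n-th power of
  \<open>A\<close> appears because a component need not return to a translate of itself at the first
  step. For the invariant sets, take a nonempty open set \<open>b\<close> and let \<open>W\<close>
  consist of the points whose orbit meets a lattice translate of \<open>b\<close>. It is open and
  contains its preimage, and for some \<open>b\<close> it is not dense. Equal area only makes the
  preimage of \<open>W\<close> dense in \<open>W\<close>, so one passes to the closure, which is its
  own preimage; its interior and its complement are the two sets. Eigenvalues are first found on the
  left, for a functional that vanishes on \<open>H\<close>, since what is known is the action on the
  quotient by \<open>H\<close>.\<close>

lemma covering_space_if_uniformly_locally_injective: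
  fixes F :: "'a::euclidean_space \<Rightarrow> 'a"
  assumes cont: "continuous_on UNIV F" and "0 < e" "0 < d"
    and inj: "\<And>x. inj_on F (ball x e)"
    and cov: "\<And>x. ball (F x) d \<subseteq> F ` ball x (e / 2)"
  shows "covering_space UNIV F UNIV"
proof -
  have open_image: "open (F ` S)" if "open S" "S \<subseteq> ball x e" for S x
    using continuous_on_subset[OF cont subset_UNIV] that(1) inj_on_subset[OF inj that(2)]
    by (rule invariance_of_domain)
  have "open (range F)"
  proof -
    have "range F = (\<Union>x. F ` ball x e)"
      using \<open>0 < e\<close> by force
    then show ?thesis
      using open_image[OF open_ball order_refl] by (simp add: open_UN)
  qed
  \<comment> \<open>The radius \<open>d\<close> is the same everywhere, so a value within
    \<open>d\<close> of a limit point \<open>y\<close> already has \<open>y\<close> in the image of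
    the ball around its argument.\<close>
  moreover have "closed (range F)"
  proof -
    have "y \<in> range F" if y: "y \<in> closure (range F)" for y
    proof -
      obtain x where "dist (F x) y < d"
        using y \<open>0 < d\<close> unfolding closure_approachable by blast
      then show ?thesis
        using cov[of x] by auto
    qed
    then show ?thesis
      using closure_subset_eq by blast
  qed
  ultimately have surj: "range F = UNIV"
    using clopen[of "range F"] by auto
  show ?thesis
  proof (rule covering_spaceI[OF cont surj])
    fix y :: 'a
    define T where "T = ball y d"
    \<comment> \<open>The sheets over \<open>T\<close>, one for each point of the fibre. Radius
      \<open>e / 2\<close> makes them disjoint: overlapping balls have centres less than
      \<open>e\<close> apart, where \<open>F\<close> is injective.\<close>
    define v where "v = (\<lambda>x. ball x (e / 2) \<inter> F -` T) ` {x. F x = y}"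
    have sub: "ball x (e / 2) \<subseteq> ball x e" for x :: 'a
      using \<open>0 < e\<close> by auto
    have openT: "open (F -` T)"
      using cont by (simp add: T_def open_vimage)
    have "\<Union>v = UNIV \<inter> F -` T"
    proof -
      have "\<exists>x. F x = y \<and> z \<in> ball x (e / 2)" if "F z \<in> T" for z
      proof -
        \<comment> \<open>\<open>cov\<close> is used at \<open>z\<close> and not at a point of the
          fibre: it yields a preimage of \<open>y\<close> within \<open>e / 2\<close> of
          \<open>z\<close>.\<close>
        have "y \<in> ball (F z) d"
          using that by (simp add: T_def dist_commute)
        then show ?thesis
          using cov[of z] by (force simp: dist_commute)
      qed
      then show ?thesis
        by (fastforce simp: v_def)
    qed
    moreover have "\<forall>u\<in>v. openin (top_of_set UNIV) u"
      using openT by (auto simp: v_def)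
    moreover have "pairwise disjnt v"
    proof -
      have "x = x'" if "F x = y" "F x' = y" "z \<in> ball x (e / 2)" "z \<in> ball x' (e / 2)" for x x' z
      proof -
        have "dist x x' < e"
          using that(3,4) dist_triangle_half_l[of x z e x'] by (auto simp: dist_commute)
        then show ?thesis
          using inj[of x] that \<open>0 < e\<close> by (auto simp: inj_on_def)
      qed
      then show ?thesis
        unfolding pairwise_def v_def disjnt_def by blast
    qed
    moreover have "\<exists>q. homeomorphism u T F q" if uv: "u \<in> v" for u
    proof -
      obtain x where x: "F x = y" and u: "u = ball x (e / 2) \<inter> F -` T"
        using uv by (auto simp: v_def)
      have inju: "inj_on F u"
        using inj[of x] u sub by (meson inf_le1 inj_on_subset order_trans)
      have "F ` u = T"
        using cov[of x] x unfolding u T_def by auto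
      moreover have "continuous_on u F"
        using cont continuous_on_subset by blast
      moreover have "open u"
        using u openT by auto
      ultimately show ?thesis
        using invariance_of_domain_homeomorphism[of u F] inju by force
    qed
    ultimately show "\<exists>T. y \<in> T \<and> openin (top_of_set UNIV) T \<and>
        (\<exists>v. \<Union>v = UNIV \<inter> F -` T \<and> (\<forall>u\<in>v. openin (top_of_set UNIV) u) \<and>
        pairwise disjnt v \<and> (\<forall>u\<in>v. \<exists>q. homeomorphism u T F q))"
      using \<open>0 < d\<close> by (intro exI[of _ T] conjI exI[of _ v]) (auto simp: T_def)
  qed
qed

text \<open>The space is simply connected, so the identity lifts to a section \<open>g\<close> with
  \<open>g (F x) = x\<close>. Then \<open>g\<close> after \<open>F\<close> and the identity are two
  lifts of \<open>F\<close> that agree at \<open>x\<close>, hence are equal, and \<open>g\<close> is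
  a left inverse.\<close>

lemma covering_space_euclidean_imp_bij:
  fixes F :: "'a::euclidean_space \<Rightarrow> 'a"
  assumes cov: "covering_space UNIV F UNIV"
  shows "bij F"
proof (rule bijI)
  show "surj F"
    using covering_space_imp_surjective[OF cov] .
  have cont: "continuous_on UNIV F"
    using covering_space_imp_continuous[OF cov] .
  show "inj F"
  proof (rule injI)
    fix x y assume eq: "F x = F y"
    obtain g where g: "continuous_on UNIV g" "g (F x) = x" "\<And>z. F (g z) = z"
      using covering_space_lift_strong[OF cov, of x "F x" UNIV "\<lambda>z. z"]
        convex_imp_simply_connected[of UNIV] convex_imp_locally_path_connected[of UNIV]
      by (auto simp: continuous_on_id)
    have gF: "continuous_on UNIV (\<lambda>z. g (F z))"
      using continuous_on_compose2[OF g(1) cont] by simp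
    have "g (F z) = z" for z
      by (rule covering_space_lift_unique[OF cov, of "\<lambda>z. g (F z)" x "\<lambda>z. z" UNIV F])
        (use g gF cont in auto)
    then show "x = y"
      using eq by metis
  qed
qed

section \<open>Integer linear maps of the plane\<close>

definition int_lattice :: "(real \<times> real) set" where
  "int_lattice = \<int> \<times> \<int>"

lemma int_latticeE:
  assumes "k \<in> int_lattice"
  obtains r s :: int where "k = (of_int r, of_int s)"
  using assms by (auto simp: int_lattice_def Ints_def)

lemma int_lattice_zero: "0 \<in> int_lattice"
  by (simp add: int_lattice_def zero_prod_def)

lemma int_lattice_add: "k \<in> int_lattice \<Longrightarrow> l \<in> int_lattice \<Longrightarrow> k + l \<in> int_lattice"
  and int_lattice_diff: "k \<in> int_lattice \<Longrightarrow> l \<in> int_lattice \<Longrightarrow> k - l \<in> int_lattice"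
  and int_lattice_uminus: "k \<in> int_lattice \<Longrightarrow> - k \<in> int_lattice"
  by (auto simp: int_lattice_def mem_Times_iff)

lemma orthogonal_decomposition_plane:
  fixes p q :: real and x :: "real \<times> real"
  shows "((p, q) \<bullet> (p, q)) *\<^sub>R x = ((p, q) \<bullet> x) *\<^sub>R (p, q) + ((- q, p) \<bullet> x) *\<^sub>R (- q, p)"
  by (cases x) (auto simp: algebra_simps)

lemma subgroup_scale_int:
  fixes H :: "'a::real_vector set"
  assumes "0 \<in> H" "\<And>k l. k \<in> H \<Longrightarrow> l \<in> H \<Longrightarrow> k + l \<in> H" "\<And>k. k \<in> H \<Longrightarrow> - k \<in> H"
    and "k \<in> H"
  shows "of_int n *\<^sub>R k \<in> H"
proof -
  have nat: "of_nat m *\<^sub>R k \<in> H" for m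
    by (induction m) (use assms in \<open>auto simp: scaleR_left_distrib\<close>)
  show ?thesis
  proof (cases n)
    case (nonneg m)
    then show ?thesis
      using nat[of m] by simp
  next
    case (neg m)
    have "of_int n = - real (Suc m)"
      using neg by simp
    then have "of_int n *\<^sub>R k = - (of_nat (Suc m) *\<^sub>R k)"
      by (metis scaleR_minus_left)
    then show ?thesis
      using assms(3) nat by metis
  qed
qed

text \<open>If \<open>H\<close> has rank one, \<open>B\<close> acts on the torsion-free part of the quotient of the lattice
  by \<open>H\<close>, an infinite cyclic group, as a surjection, hence as multiplication by \<open>1\<close> or \<open>-1\<close>.\<close>
lemma invariant_subgroup_full_rank_or_eigenvalue:
  fixes B :: "real \<times> real \<Rightarrow> real \<times> real"
  assumes H: "H \<subseteq> int_lattice" "0 \<in> H" "\<And>k l. k \<in> H \<Longrightarrow> l \<in> H \<Longrightarrow> k + l \<in> H"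
      "\<And>k. k \<in> H \<Longrightarrow> - k \<in> H"
    and B: "linear B" "B ` int_lattice \<subseteq> int_lattice" "B ` H \<subseteq> H"
    and cover: "\<And>m. m \<in> int_lattice \<Longrightarrow> \<exists>k\<in>int_lattice. m - B k \<in> H"
    and nonsurj: "\<not> int_lattice \<subseteq> B ` int_lattice"
  shows "(\<exists>m::int. m \<noteq> 0 \<and> (of_int m, 0) \<in> H \<and> (0, of_int m) \<in> H) \<or>
         (\<exists>w \<mu>. w \<noteq> 0 \<and> \<bar>\<mu>\<bar> = 1 \<and> (\<forall>x. w \<bullet> B x = \<mu> * (w \<bullet> x)))"
proof -
  \<comment> \<open>For trivial \<open>H\<close> the covering hypothesis would say that every
    lattice vector is a value of \<open>B\<close> on the lattice.\<close>
  have "H \<noteq> {0}"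
    using cover nonsurj by fastforce
  then obtain h where h: "h \<in> H" "h \<noteq> 0"
    using H(2) by blast
  then obtain p q :: int where hpq: "h = (of_int p, of_int q)"
    using H(1) int_latticeE by blast
  have pq: "p \<noteq> 0 \<or> q \<noteq> 0"
    using h(2) hpq by (auto simp: zero_prod_def)
  \<comment> \<open>\<open>h\<close> turned by a right angle: the inner product of \<open>w\<close>
    with a vector is the determinant of \<open>h\<close> and that vector.\<close>
  define w :: "real \<times> real" where "w = (- of_int q, of_int p)"
  have w0: "w \<noteq> 0"
    using pq by (auto simp: w_def zero_prod_def)
  show ?thesis
  proof (cases "\<exists>h'\<in>H. w \<bullet> h' \<noteq> 0")
    case True
    then obtain h' where h': "h' \<in> H" "w \<bullet> h' \<noteq> 0"
      by blast
    then obtain r s :: int where hrs: "h' = (of_int r, of_int s)"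
      using H(1) int_latticeE by blast
    \<comment> \<open>The determinant of \<open>h\<close> and \<open>h'\<close>. As in Cramer's
      rule, \<open>m\<close> times each unit vector is an integer combination of the two.\<close>
    define m where "m = p * s - q * r"
    have "m \<noteq> 0"
    proof
      assume "m = 0"
      then have "real_of_int p * of_int s - of_int q * of_int r = 0"
        unfolding m_def by (metis of_int_0 of_int_diff of_int_mult)
      then show False
        using h'(2) by (simp add: w_def hrs)
    qed
    moreover have "of_int s *\<^sub>R h - of_int q *\<^sub>R h' \<in> H" "of_int p *\<^sub>R h' - of_int r *\<^sub>R h \<in> H"
      using subgroup_scale_int[OF H(2-4)] h(1) h'(1) H(3,4) by (metis add_uminus_conv_diff)+
    then have "(of_int m, 0) \<in> H" "(0, of_int m) \<in> H"
      by (simp_all add: hpq hrs m_def algebra_simps)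
    ultimately show ?thesis
      by blast
  next
    case False
    then have wH: "w \<bullet> k = 0" if "k \<in> H" for k
      using that by blast
    define \<mu> where "\<mu> = (w \<bullet> B w) / (w \<bullet> w)"
    have ww: "w \<bullet> w = h \<bullet> h" "w \<bullet> w \<noteq> 0"
      using w0 by (simp add: w_def hpq) (use w0 in simp)
    have eig: "w \<bullet> B x = \<mu> * (w \<bullet> x)" for x
    proof -
      have "(w \<bullet> w) *\<^sub>R x = (h \<bullet> x) *\<^sub>R h + (w \<bullet> x) *\<^sub>R w"
        unfolding ww(1) unfolding hpq w_def by (rule orthogonal_decomposition_plane)
      then have "B ((w \<bullet> w) *\<^sub>R x) = B ((h \<bullet> x) *\<^sub>R h + (w \<bullet> x) *\<^sub>R w)"
        by simp
      then have "(w \<bullet> w) *\<^sub>R B x = (h \<bullet> x) *\<^sub>R B h + (w \<bullet> x) *\<^sub>R B w"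
        using B(1) by (simp add: linear_add linear_scale)
      then have "w \<bullet> ((w \<bullet> w) *\<^sub>R B x) = w \<bullet> ((h \<bullet> x) *\<^sub>R B h + (w \<bullet> x) *\<^sub>R B w)"
        by simp
      then have "(w \<bullet> w) * (w \<bullet> B x) = (w \<bullet> x) * (w \<bullet> B w)"
        using wH[of "B h"] h(1) B(3) by (auto simp: inner_add_right)
      then show ?thesis
        using ww(2) by (simp add: \<mu>_def field_simps)
    qed
    \<comment> \<open>On the lattice the functional \<open>w\<close> takes only multiples of
      \<open>g\<close>, and by Bezout it takes the value \<open>g\<close> itself at
      \<open>k\<close>. It thus identifies the lattice modulo its kernel with the multiples of
      \<open>g\<close>, on which \<open>B\<close> acts as multiplication by \<mu>.\<close>
    define g where "g = gcd p q"
    have g0: "g \<noteq> 0"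
      using pq by (simp add: g_def)
    have mult: "\<exists>a::int. w \<bullet> k = of_int (g * a)" if k: "k \<in> int_lattice" for k
    proof -
      obtain r s :: int where "k = (of_int r, of_int s)"
        using k int_latticeE by blast
      then have "w \<bullet> k = of_int (p * s - q * r)"
        by (simp add: w_def)
      moreover have "g dvd p * s - q * r"
        by (simp add: g_def)
      ultimately show ?thesis
        by (metis dvdE)
    qed
    obtain u v where uv: "u * p + v * q = g"
      using bezout_int unfolding g_def by blast
    define k where "k = (- real_of_int v, real_of_int u)"
    have k: "k \<in> int_lattice" "w \<bullet> k = of_int g"
      by (auto simp: int_lattice_def k_def w_def algebra_simps simp flip: uv)
    obtain k' where k': "k' \<in> int_lattice" "k - B k' \<in> H"
      using cover k(1) by blast
    obtain a where a: "w \<bullet> k' = of_int (g * a)"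
      using mult k'(1) by blast
    obtain b where b: "w \<bullet> B k = of_int (g * b)"
      using mult B(2) k(1) by blast
    \<comment> \<open>Surjectivity modulo \<open>H\<close> makes \<mu> a divisor of 1, and
      \<open>w\<close> evaluated at \<open>B k\<close> makes it an integer; so it is a unit.\<close>
    have "of_int g = \<mu> * of_int (g * a)"
      using wH[OF k'(2)] k(2) eig[of k'] a by (simp add: inner_diff_right)
    then have 1: "\<mu> * of_int a = 1"
      using g0 by (simp add: field_simps)
    have 2: "\<mu> = of_int b"
      using eig[of k] k(2) b g0 by (simp add: field_simps)
    have "real_of_int (b * a) = 1"
      using 1 2 by simp
    then have "b * a = 1"
      using of_int_eq_1_iff by blast
    then have "\<bar>b\<bar> = 1"
      by (metis abs_1 zmult_eq_1_iff abs_minus)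
    then have "\<bar>\<mu>\<bar> = 1"
      using 2 by (metis of_int_1 of_int_abs)
    then show ?thesis
      using eig w0 by blast
  qed
qed

text \<open>If \<open>w\<close> were not itself a left eigenvector of \<open>L\<close>, then \<open>w\<close> and \<open>w L\<close> would be two
  independent functionals fixed by \<open>L ^^ (2 * n)\<close>, making it the identity.\<close>
lemma left_eigenvalue_of_funpow:
  fixes L :: "real \<times> real \<Rightarrow> real \<times> real"
  assumes L: "linear L" "L ` int_lattice \<subseteq> int_lattice"
    and nonsurj: "\<not> int_lattice \<subseteq> L ` int_lattice"
    and "0 < n" and w: "w \<noteq> 0" and \<mu>: "\<bar>\<mu>\<bar> = 1"
    and eig: "\<And>x. w \<bullet> (L ^^ n) x = \<mu> * (w \<bullet> x)"
  shows "\<exists>c. \<bar>c\<bar> = 1 \<and> (\<forall>x. w \<bullet> L x = c * (w \<bullet> x))"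
proof -
  \<comment> \<open>Doubling the exponent removes the sign of \<mu>.\<close>
  have fix2: "w \<bullet> (L ^^ (n + n)) x = w \<bullet> x" for x
  proof -
    have "\<mu> * \<mu> = 1"
      using \<mu> by (metis abs_mult_self_eq mult_1)
    then show ?thesis
      by (simp add: funpow_add eig flip: mult.assoc)
  qed
  \<comment> \<open>The vector that represents the functional \<open>w\<close> after
    \<open>L\<close>. The case distinction below is whether \<open>w\<close> and \<open>r\<close>
    are parallel.\<close>
  define r where "r = (w \<bullet> L (1, 0), w \<bullet> L (0, 1))"
  have r: "w \<bullet> L x = r \<bullet> x" for x
  proof -
    have "x = fst x *\<^sub>R (1, 0) + snd x *\<^sub>R (0, 1)"
      by (cases x) auto
    then have "L x = L (fst x *\<^sub>R (1, 0) + snd x *\<^sub>R (0, 1))"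
      by (rule arg_cong)
    also have "\<dots> = fst x *\<^sub>R L (1, 0) + snd x *\<^sub>R L (0, 1)"
      unfolding linear_add[OF L(1)] linear_scale[OF L(1)] ..
    finally have "L x = fst x *\<^sub>R L (1, 0) + snd x *\<^sub>R L (0, 1)" .
    then show ?thesis
      by (cases x) (simp add: r_def inner_add_right)
  qed
  show ?thesis
  proof (cases "fst w * snd r = snd w * fst r")
    case True
    define c where "c = (w \<bullet> r) / (w \<bullet> w)"
    have "w \<bullet> w \<noteq> 0"
      using w by simp
    have "(w \<bullet> w) *\<^sub>R r = (w \<bullet> r) *\<^sub>R w"
      using True by (cases w; cases r) (auto simp: algebra_simps)
    then have "(w \<bullet> w) * (r \<bullet> x) = (w \<bullet> r) * (w \<bullet> x)" for x
      by (metis inner_scaleR_left)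
    then have c: "w \<bullet> L x = c * (w \<bullet> x)" for x
      using \<open>w \<bullet> w \<noteq> 0\<close> by (simp add: r c_def field_simps)
    have "w \<bullet> (L ^^ m) x = c ^ m * (w \<bullet> x)" for m x
      by (induction m) (auto simp: c)
    then have "c ^ n * (w \<bullet> w) = \<mu> * (w \<bullet> w)"
      using eig by metis
    then have "c ^ n = \<mu>"
      using \<open>w \<bullet> w \<noteq> 0\<close> by simp
    then have "\<bar>c\<bar> ^ n = 1"
      using \<mu> by (metis power_abs)
    then have "\<bar>c\<bar> = 1"
      using \<open>0 < n\<close> by (metis abs_ge_zero power_eq_1_iff abs_of_nonneg not_gr_zero real_norm_def)
    then show ?thesis
      using c by blast
  next
    case False
    have "(L ^^ (n + n)) x = x" for x
    proof -
      define y where "y = (L ^^ (n + n)) x - x"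
      have wy: "w \<bullet> y = 0"
        by (simp add: y_def inner_diff_right fix2)
      have "r \<bullet> (L ^^ (n + n)) x = w \<bullet> (L ^^ (n + n)) (L x)"
        by (metis r funpow_swap1)
      then have ry: "r \<bullet> y = 0"
        by (simp add: y_def inner_diff_right fix2 r)
      obtain a b where ab: "y = (a, b)"
        by (cases y) auto
      have 1: "fst w * a + snd w * b = 0" "fst r * a + snd r * b = 0"
        using wy ry by (auto simp: ab inner_prod_def)
      have "(fst w * snd r - snd w * fst r) * a = 0" "(fst w * snd r - snd w * fst r) * b = 0"
        using 1 by algebra+
      then have "y = 0"
        using False by (simp add: ab zero_prod_def)
      then show ?thesis
        by (simp add: y_def)
    qed
    \<comment> \<open>One factor \<open>L\<close> is split off the identity; the remaining power
      preserves the lattice, so \<open>L\<close> would be onto it.\<close>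
    moreover obtain m where "n + n = Suc m"
      using \<open>0 < n\<close> by (metis Suc_pred add_gr_0)
    ultimately have "L ((L ^^ m) x) = x" for x
      by (metis comp_apply funpow.simps(2))
    moreover have "(L ^^ m) k \<in> int_lattice" if "k \<in> int_lattice" for k
      by (induction m) (use that L(2) in \<open>auto simp: image_subset_iff\<close>)
    ultimately have "int_lattice \<subseteq> L ` int_lattice"
      by (metis image_eqI subsetI)
    then show ?thesis
      using nonsurj by blast
  qed
qed

text \<open>\<open>w\<close> is orthogonal to the range of \<open>L - c\<close>. If that map were
  injective, its range would be the whole space and contain \<open>w\<close>, which is not
  orthogonal to itself.\<close>

lemma right_eigenvector_of_left:
  fixes L :: "'a::euclidean_space \<Rightarrow> 'a"
  assumes "linear L" "w \<noteq> 0" "\<And>x. w \<bullet> L x = c * (w \<bullet> x)"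
  shows "\<exists>v. v \<noteq> 0 \<and> L v = c *\<^sub>R v"
proof (rule ccontr)
  assume no: "\<nexists>v. v \<noteq> 0 \<and> L v = c *\<^sub>R v"
  have lin: "linear (\<lambda>x. L x - c *\<^sub>R x)"
    using assms(1) by (intro linear_compose_sub linear_compose_scale_right) (auto simp: linear_id[unfolded id_def])
  then have "inj (\<lambda>x. L x - c *\<^sub>R x)"
    using no by (subst linear_injective_0) auto
  then have "surj (\<lambda>x. L x - c *\<^sub>R x)"
    using lin linear_injective_imp_surjective by blast
  then obtain x where "w = L x - c *\<^sub>R x"
    by blast
  then have "w \<bullet> w = 0"
    using assms(3)[of x] by (metis inner_diff_right inner_scaleR_right right_minus_eq)
  then show False
    using assms(2) by simp
qed

section \<open>Disjoint periodic domains in the plane\<close>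

lemma path_component_translate:
  fixes S :: "'a::real_normed_vector set"
  assumes "path_component S x y" and "\<And>z. z \<in> S \<Longrightarrow> z + v \<in> S"
  shows "path_component S (x + v) (y + v)"
proof -
  have "path_component ((+) v ` S) (v + x) (v + y)"
    using assms(1) unfolding path_component_def
    by (metis path_image_translation path_translation_eq pathfinish_translation
        pathstart_translation image_mono)
  moreover have "(+) v ` S \<subseteq> S"
    using assms(2) by (auto simp: add.commute)
  ultimately show ?thesis
    by (metis add.commute path_component_of_subset)
qed

lemma path_component_translate_iterate:
  fixes S :: "'a::real_normed_vector set"
  assumes xv: "path_component S x (x + v)" and inv: "\<And>z. z \<in> S \<Longrightarrow> z + v \<in> S"
  shows "path_component S x (x + real n *\<^sub>R v)"
proof (induction n)
  case 0
  then show ?case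
    using path_component_mem(1)[OF xv] by (simp add: path_component_refl)
next
  case (Suc n)
  have "path_component S (x + v) (x + real n *\<^sub>R v + v)"
    using path_component_translate[OF Suc inv] .
  then have "path_component S x (x + real n *\<^sub>R v + v)"
    using xv path_component_trans by blast
  then show ?case
    by (simp add: algebra_simps)
qed

text \<open>The Fashoda meet theorem, carried from \<open>real^2\<close> to pairs by the coordinate
  map \<open>e\<close>.\<close>

lemma fashoda_product:
  fixes f g :: "real \<Rightarrow> real \<times> real"
  assumes "path f" "path g"
    and "path_image f \<subseteq> {-X..X} \<times> {-Y..Y}" "path_image g \<subseteq> {-X..X} \<times> {-Y..Y}"
    and "fst (pathstart f) = -X" "fst (pathfinish f) = X"
    and "snd (pathstart g) = -Y" "snd (pathfinish g) = Y"
  shows "path_image f \<inter> path_image g \<noteq> {}"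
proof -
  define e :: "real \<times> real \<Rightarrow> real^2" where "e = (\<lambda>z. vector [fst z, snd z])"
  have e: "e z $ 1 = fst z" "e z $ 2 = snd z" for z
    by (simp_all add: e_def)
  have conte: "continuous_on S e" for S
  proof -
    have "continuous_on S (\<lambda>z. (\<chi> i. if i = 1 then fst z else snd z) :: real^2)"
    proof (rule continuous_on_vec_lambda)
      show "continuous_on S (\<lambda>z. if i = 1 then fst z else snd z)" for i :: 2
        by (cases "i = 1") (auto intro!: continuous_intros)
    qed
    moreover have "e = (\<lambda>z. \<chi> i. if i = 1 then fst z else snd z)"
      by (auto simp: vec_eq_iff forall_2 e)
    ultimately show ?thesis
      by simp
  qed
  have "path (e \<circ> f)" "path (e \<circ> g)"
    using assms(1,2) conte path_continuous_image by blast+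
  moreover have "e ` ({-X..X} \<times> {-Y..Y}) \<subseteq> cbox (e (-X, -Y)) (e (X, Y))"
    by (auto simp: mem_box_cart forall_2 e)
  then have "path_image (e \<circ> f) \<subseteq> cbox (e (-X, -Y)) (e (X, Y))"
    "path_image (e \<circ> g) \<subseteq> cbox (e (-X, -Y)) (e (X, Y))"
    using assms(3,4) by (auto simp: path_image_compose)
  ultimately obtain z where "z \<in> path_image (e \<circ> f)" "z \<in> path_image (e \<circ> g)"
    by (rule fashoda) (use assms(5-8) in \<open>auto simp: pathstart_compose pathfinish_compose e\<close>)
  then obtain a b where "a \<in> path_image f" "b \<in> path_image g" "e a = e b"
    by (auto simp: path_image_compose)
  moreover from this have "a = b"
    by (metis e prod_eq_iff)
  ultimately show ?thesis
    by blast
qed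

lemma path_component_linepath:
  fixes S :: "'a::real_normed_vector set"
  assumes "closed_segment x y \<subseteq> S"
  shows "path_component S x y"
  unfolding path_component_def using assms
  by (intro exI[of _ "linepath x y"]) auto

text \<open>A path in \<open>C\<close> from \<open>p\<close> to \<open>p + (m, 0)\<close> is
  repeated in both directions. Its height stays below a bound \<open>R\<close> that does not depend
  on the width \<open>X\<close>. The ends must have abscissa exactly \<open>-X\<close> and
  \<open>X\<close>, so straight horizontal pieces are attached, and these may leave
  \<open>C\<close>; the conclusion therefore asks for membership in \<open>C\<close> only where the
  abscissa is at most \<open>R\<close> in modulus. This is enough, since a crossing path in the
  other direction with the same \<open>R\<close> stays in that strip.\<close>

lemma horizontally_periodic_crossing:
  fixes C :: "(real \<times> real) set"
  assumes "open C" "connected C" "C \<noteq> {}" "0 < m"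
    and inv: "\<And>z. z + (m, 0) \<in> C \<longleftrightarrow> z \<in> C"
  shows "\<exists>R0. \<forall>R\<ge>R0. \<exists>X0. \<forall>X\<ge>X0. \<exists>f. path f \<and>
           fst (pathstart f) = -X \<and> fst (pathfinish f) = X \<and>
           path_image f \<subseteq> {z. \<bar>fst z\<bar> \<le> X \<and> \<bar>snd z\<bar> \<le> R \<and> (z \<in> C \<or> R < \<bar>fst z\<bar>)}"
proof -
  obtain p where p: "p \<in> C"
    using assms by blast
  define v where "v = (m, 0::real)"
  have "path_connected C"
    using assms by (simp add: connected_open_path_connected)
  then obtain \<gamma> where \<gamma>: "path \<gamma>" "path_image \<gamma> \<subseteq> C" "pathstart \<gamma> = p" "pathfinish \<gamma> = p + v"
    using p inv unfolding path_connected_def v_def by meson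
  obtain R0 where R0: "\<And>z. z \<in> path_image \<gamma> \<Longrightarrow> norm z \<le> R0"
    using bounded_path_image[OF \<gamma>(1)] bounded_iff by blast
  have snd_le: "\<bar>snd z\<bar> \<le> norm z" and fst_le: "\<bar>fst z\<bar> \<le> norm z" for z :: "real \<times> real"
    by (metis norm_snd_le norm_fst_le real_norm_def prod.collapse)+
  show ?thesis
  proof (rule exI[of _ R0], intro allI impI)
    fix R assume R: "R0 \<le> R"
    define S where "S = {z \<in> C. \<bar>snd z\<bar> \<le> R}"
    have "path_image \<gamma> \<subseteq> S"
    proof
      fix z assume z: "z \<in> path_image \<gamma>"
      show "z \<in> S"
        using z \<gamma>(2) R0[OF z] R snd_le[of z] by (auto simp: S_def)
    qed
    then have step: "path_component S p (p + v)"
      using \<gamma> unfolding path_component_def by blast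
    have invS: "z + v \<in> S" "z + - v \<in> S" if "z \<in> S" for z
      using that inv[of z] inv[of "z - v", folded v_def] by (simp_all add: S_def) (simp_all add: v_def)
    have step': "path_component S p (p + - v)"
      using path_component_translate[OF step invS(2)] path_component_sym by force
    have pR: "\<bar>snd p\<bar> \<le> R"
      using path_component_mem(1)[OF step] by (simp add: S_def)
    \<comment> \<open>Enough repetitions to carry both ends out of the strip in which the curve has
      to stay in \<open>C\<close>.\<close>
    obtain N :: nat where N: "R + \<bar>fst p\<bar> < N * m"
      using reals_Archimedean3[OF \<open>0 < m\<close>] by blast
    define a where "a = p + real N *\<^sub>R - v"
    define b where "b = p + real N *\<^sub>R v"
    have ab: "fst a < -R" "snd a = snd p" "R < fst b" "snd b = snd p"
      using N by (auto simp: a_def b_def v_def)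
    have "path_component S a b"
      using path_component_translate_iterate[OF step invS(1), of N]
        path_component_translate_iterate[OF step' invS(2), of N]
      unfolding a_def b_def by (meson path_component_sym path_component_trans)
    then obtain g where g: "path g" "path_image g \<subseteq> S" "pathstart g = a" "pathfinish g = b"
      unfolding path_component_def by blast
    obtain X0 where X0: "\<And>z. z \<in> path_image g \<Longrightarrow> norm z \<le> X0"
      using bounded_path_image[OF g(1)] bounded_iff by blast
    show "\<exists>X0. \<forall>X\<ge>X0. \<exists>f. path f \<and> fst (pathstart f) = -X \<and> fst (pathfinish f) = X \<and>
           path_image f \<subseteq> {z. \<bar>fst z\<bar> \<le> X \<and> \<bar>snd z\<bar> \<le> R \<and> (z \<in> C \<or> R < \<bar>fst z\<bar>)}"
    proof (rule exI[of _ X0], intro allI impI)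
      fix X assume X: "X0 \<le> X"
      define T where "T = {z. \<bar>fst z\<bar> \<le> X \<and> \<bar>snd z\<bar> \<le> R \<and> (z \<in> C \<or> R < \<bar>fst z\<bar>)}"
      have gX: "\<bar>fst z\<bar> \<le> X" if "z \<in> path_image g" for z
        using X0[OF that] X fst_le[of z] by simp
      then have "path_image g \<subseteq> T"
        using g(2) by (auto simp: T_def S_def)
      then have Tab: "path_component T a b"
        using g unfolding path_component_def by blast
      have "\<bar>fst a\<bar> \<le> X" "\<bar>fst b\<bar> \<le> X"
        using gX g(3,4) by (metis pathstart_in_path_image pathfinish_in_path_image)+
      then have "closed_segment (-X, snd p) a \<subseteq> {-X..fst a} \<times> {snd p}"
        "closed_segment b (X, snd p) \<subseteq> {fst b..X} \<times> {snd p}"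
        using ab by (intro closed_segment_subset convex_Times; force simp: mem_Times_iff)+
      moreover have "{-X..fst a} \<times> {snd p} \<subseteq> T" "{fst b..X} \<times> {snd p} \<subseteq> T"
        using ab pR \<open>\<bar>fst a\<bar> \<le> X\<close> \<open>\<bar>fst b\<bar> \<le> X\<close> by (auto simp: T_def)
      ultimately have "path_component T (-X, snd p) (X, snd p)"
        using Tab by (meson path_component_linepath path_component_trans order_trans)
      then show "\<exists>f. path f \<and> fst (pathstart f) = -X \<and> fst (pathfinish f) = X \<and>
           path_image f \<subseteq> {z. \<bar>fst z\<bar> \<le> X \<and> \<bar>snd z\<bar> \<le> R \<and> (z \<in> C \<or> R < \<bar>fst z\<bar>)}"
        unfolding path_component_def T_def by force
    qed
  qed
qed

text \<open>Swapping coordinates turns the vertical period of \<open>D\<close> into a horizontal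
  one, so one crossing lemma serves both sets. A common \<open>R\<close> confines the meeting point
  to the square of half-side \<open>R\<close>, where both curves run inside their domains.\<close>

lemma periodic_domains_intersect:
  fixes C D :: "(real \<times> real) set"
  assumes C: "open C" "connected C" "C \<noteq> {}" "0 < m" "\<And>z. z + (m, 0) \<in> C \<longleftrightarrow> z \<in> C"
    and D: "open D" "connected D" "D \<noteq> {}" "0 < n" "\<And>z. z + (0, n) \<in> D \<longleftrightarrow> z \<in> D"
  shows "C \<inter> D \<noteq> {}"
proof -
  let ?crossing = "\<lambda>C R X f. path f \<and> fst (pathstart f) = -X \<and> fst (pathfinish f) = X \<and>
     path_image f \<subseteq> {z. \<bar>fst z\<bar> \<le> X \<and> \<bar>snd z\<bar> \<le> R \<and> (z \<in> C \<or> R < \<bar>fst z\<bar>)}"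
  define E where "E = prod.swap -` D"
  have cont_swap: "continuous_on S prod.swap" for S :: "(real \<times> real) set"
    unfolding prod.swap_def by (intro continuous_intros)
  have E: "E = prod.swap ` D"
    by (force simp: E_def)
  have "open E"
    using D(1) cont_swap unfolding E_def by (simp add: open_vimage)
  moreover have "connected E"
    using D(2) cont_swap unfolding E by (rule connected_continuous_image[rotated])
  moreover have "E \<noteq> {}"
    using D(3) E by simp
  moreover have "z + (n, 0) \<in> E \<longleftrightarrow> z \<in> E" for z
    using D(5)[of "prod.swap z"] by (cases z) (simp add: E_def)
  ultimately obtain R2 where R2: "\<forall>R\<ge>R2. \<exists>X0. \<forall>X\<ge>X0. \<exists>f. ?crossing E R X f"
    using horizontally_periodic_crossing[of E n] D(4) by blast
  obtain R1 where R1: "\<forall>R\<ge>R1. \<exists>X0. \<forall>X\<ge>X0. \<exists>f. ?crossing C R X f"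
    using horizontally_periodic_crossing[OF C] by blast
  define R where "R = max R1 R2"
  obtain X1 X2 where X1: "\<forall>X\<ge>X1. \<exists>f. ?crossing C R X f" and X2: "\<forall>X\<ge>X2. \<exists>f. ?crossing E R X f"
  proof -
    have "R1 \<le> R" "R2 \<le> R"
      by (auto simp: R_def)
    then show ?thesis
      using R1 R2 that by blast
  qed
  define X where "X = max R (max X1 X2)"
  obtain f h where f: "?crossing C R X f" and h: "?crossing E R X h"
  proof -
    have "X1 \<le> X" "X2 \<le> X"
      by (auto simp: X_def)
    then have "\<exists>f. ?crossing C R X f" "\<exists>f. ?crossing E R X f"
      using X1 X2 by simp_all
    then show ?thesis
      using that by (elim exE)
  qed
  have RX: "R \<le> X"
    by (simp add: X_def)
  have "path (prod.swap \<circ> h)"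
    using h cont_swap path_continuous_image by blast
  moreover have "path_image f \<subseteq> {-X..X} \<times> {-X..X}" "path_image (prod.swap \<circ> h) \<subseteq> {-X..X} \<times> {-X..X}"
    using f h RX by (auto simp: path_image_compose abs_le_iff dest!: subsetD)
  ultimately have "path_image f \<inter> path_image (prod.swap \<circ> h) \<noteq> {}"
    using f h by (intro fashoda_product[of _ _ X X]) (auto simp: pathstart_compose pathfinish_compose)
  then obtain z where "z \<in> path_image f" "prod.swap z \<in> path_image h"
    by (force simp: path_image_compose)
  \<comment> \<open>The curve \<open>f\<close> bounds the ordinate of \<open>z\<close> by
    \<open>R\<close> and the swapped curve bounds its abscissa by \<open>R\<close>, which excludes
    the second alternative in both.\<close>
  then have "z \<in> C" "prod.swap z \<in> E"
    using f h by (auto dest!: subsetD)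
  then show ?thesis
    by (auto simp: E_def)
qed

section \<open>Dynamics of the lift\<close>

text \<open>These sets are the preimages under \<open>torus_proj\<close> of subsets of the torus.
  Closure under addition suffices, as the lattice contains negatives.\<close>

definition periodic :: "(real \<times> real) set \<Rightarrow> bool" where
  "periodic S \<longleftrightarrow> (\<forall>x\<in>S. \<forall>k\<in>int_lattice. x + k \<in> S)"

abbreviation unit_square :: "(real \<times> real) set" where
  "unit_square \<equiv> {0..1} \<times> {0..1}"

lemma periodic_iff:
  assumes S: "periodic S" and k: "k \<in> int_lattice"
  shows "x + k \<in> S \<longleftrightarrow> x \<in> S"
proof
  assume "x + k \<in> S"
  then have "x + k + - k \<in> S"
    using S int_lattice_uminus[OF k] unfolding periodic_def by blast
  then show "x \<in> S"
    by (simp add: add.assoc)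
qed (use assms in \<open>simp add: periodic_def\<close>)

lemma periodic_Diff: "periodic S \<Longrightarrow> periodic T \<Longrightarrow> periodic (S - T)"
  unfolding periodic_def[of "S - T"] by (simp add: periodic_iff)

lemma periodic_Compl: "periodic S \<Longrightarrow> periodic (- S)"
  unfolding periodic_def[of "- S"] by (simp add: periodic_iff)

lemma periodic_closure:
  assumes "periodic S"
  shows "periodic (closure S)"
  unfolding periodic_def
proof (intro ballI)
  fix x k assume x: "x \<in> closure S" and k: "k \<in> int_lattice"
  have "(+) k ` S \<subseteq> S"
    using periodic_iff[OF assms k] by (simp add: image_subset_iff add.commute[of k])
  then have "(+) k ` closure S \<subseteq> closure S"
    unfolding closure_translation[symmetric] by (rule closure_mono)
  then show "x + k \<in> closure S"
    using x by (simp add: image_subset_iff add.commute[of k])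
qed

lemma periodic_interior: "periodic S \<Longrightarrow> periodic (interior S)"
  by (simp add: interior_closure periodic_Compl periodic_closure)

lemma ex_lattice_translate_unit_square:
  fixes x :: "real \<times> real"
  shows "\<exists>k\<in>int_lattice. x + k \<in> unit_square"
proof -
  have "x + (- of_int \<lfloor>fst x\<rfloor>, - of_int \<lfloor>snd x\<rfloor>) \<in> unit_square"
    by (cases x) (auto, linarith+)
  then show ?thesis
    by (metis Ints_minus Ints_of_int int_lattice_def mem_Sigma_iff)
qed

lemma unit_square_Int_sets: "open S \<Longrightarrow> S \<inter> unit_square \<in> sets lborel"
  using closed_Times[of "{0..1::real}" "{0..1::real}"] by auto

text \<open>A nonempty such set meets the closed square, hence the open one whose closure it is, in
  a nonempty open set, which has positive area. Every passage from area to topology below goes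
  through this lemma.\<close>

lemma periodic_open_null_imp_empty:
  assumes "open S" "periodic S" and null: "emeasure lborel (S \<inter> unit_square) = 0"
  shows "S = {}"
proof (rule ccontr)
  define I :: "(real \<times> real) set" where "I = {0<..<1} \<times> {0<..<1}"
  have closI: "closure I = unit_square"
    by (simp add: I_def closure_Times)
  assume "S \<noteq> {}"
  then obtain x where "x \<in> S" "x \<in> unit_square"
    using ex_lattice_translate_unit_square assms(2) unfolding periodic_def by (metis ex_in_conv)
  then have "S \<inter> I \<noteq> {}"
    using open_Int_closure_eq_empty[OF assms(1), of I] closI by blast
  moreover have "open (S \<inter> I)"
    using assms(1) by (auto simp: I_def open_Times)
  ultimately have "\<not> negligible (S \<inter> I)"
    by (rule open_not_negligible[rotated])
  moreover have "emeasure lborel (S \<inter> I) = 0"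
  proof -
    have "S \<inter> I \<subseteq> S \<inter> unit_square"
      by (auto simp: I_def)
    then have "emeasure lborel (S \<inter> I) \<le> emeasure lborel (S \<inter> unit_square)"
      using unit_square_Int_sets[OF assms(1)] by (rule emeasure_mono)
    then show ?thesis
      using null by simp
  qed
  then have "S \<inter> I \<in> null_sets lborel"
    using \<open>open (S \<inter> I)\<close> by (auto simp: null_sets_def)
  then have "negligible (S \<inter> I)"
    by (simp add: negligible_iff_null_sets null_sets_completionI)
  ultimately show False
    by blast
qed

lemma emeasure_unit_square: "emeasure lborel unit_square = 1"
proof -
  have "unit_square = cbox (0, 0) (1, 1)"
    by (simp add: cbox_Pair_eq)
  then show ?thesis
    by (simp add: emeasure_lborel_cbox_eq Basis_prod_def)
qed

lemma emeasure_unit_square_less_top: "emeasure lborel (S \<inter> unit_square) < top"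
proof -
  have "emeasure lborel (S \<inter> unit_square) \<le> emeasure lborel unit_square"
    using unit_square_Int_sets[OF open_UNIV] by (intro emeasure_mono) auto
  then show ?thesis
    by (simp add: emeasure_unit_square le_less_trans[OF _ ennreal_one_less_top])
qed

section \<open>Components of periodic open sets and their lattice translates\<close>

lemma connected_component_add_lattice:
  assumes "periodic U" and k: "k \<in> int_lattice"
  shows "connected_component U (x + k) (y + k) \<longleftrightarrow> connected_component U x y"
proof -
  have "homeomorphism U U (\<lambda>z. z + k) (\<lambda>z. z - k)"
  proof (rule homeomorphismI)
    show "(\<lambda>z. z + k) ` U \<subseteq> U" "(\<lambda>z. z - k) ` U \<subseteq> U"
      using assms(1) k int_lattice_uminus[OF k] unfolding periodic_def
      by (auto simp flip: add_uminus_conv_diff)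
  qed (auto intro!: continuous_intros)
  from connected_component_homeomorphism_iff[OF this, of x y]
  show ?thesis
    using periodic_iff[OF assms] by (metis connected_component_in)
qed

text \<open>For periodic \<open>U\<close>, the union of all lattice translates of the component of
  \<open>x\<close>. Unlike the component it is periodic, so area preservation applies to it.\<close>

definition component_orbit :: "(real \<times> real) set \<Rightarrow> real \<times> real \<Rightarrow> (real \<times> real) set" where
  "component_orbit U x = {y. \<exists>k\<in>int_lattice. connected_component U (x + k) y}"

lemma open_component_orbit:
  assumes "open U"
  shows "open (component_orbit U x)"
proof -
  have "component_orbit U x = (\<Union>k\<in>int_lattice. connected_component_set U (x + k))"
    by (auto simp: component_orbit_def)
  then show ?thesis
    using open_connected_component[OF assms] by (simp add: open_UN)
qed

lemma periodic_component_orbit: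
  assumes "periodic U"
  shows "periodic (component_orbit U x)"
  unfolding periodic_def
proof (intro ballI)
  fix y k assume "y \<in> component_orbit U x" and k: "k \<in> int_lattice"
  then obtain l where "l \<in> int_lattice" "connected_component U (x + l) y"
    by (auto simp: component_orbit_def)
  then have "l + k \<in> int_lattice" "connected_component U (x + (l + k)) (y + k)"
    using connected_component_add_lattice[OF assms k] int_lattice_add[OF _ k]
    by (auto simp flip: add.assoc)
  then show "y + k \<in> component_orbit U x"
    unfolding component_orbit_def by blast
qed

lemma funpow_Suc_vimage: "(f ^^ Suc n) -` S = f -` ((f ^^ n) -` S)"
  by (simp only: funpow_Suc_right vimage_comp)

text \<open>The hypotheses are chosen to pass to iterates, since the arguments are applied to a
  power of the lift. \<open>L_nonsurj\<close> encodes degree at least two. Area is compared on open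
  periodic sets, a class closed under preimages by \<open>F\<close>.\<close>

locale torus_lift =
  fixes F L :: "real \<times> real \<Rightarrow> real \<times> real"
  assumes cont: "continuous_on UNIV F" and bij: "bij F"
    and linear_L: "linear L" and L_lattice: "L ` int_lattice \<subseteq> int_lattice"
    and L_nonsurj: "\<not> int_lattice \<subseteq> L ` int_lattice"
    and equivariant: "\<And>x k. k \<in> int_lattice \<Longrightarrow> F (x + k) = F x + L k"
    and preserving: "\<And>S. open S \<Longrightarrow> periodic S \<Longrightarrow>
      emeasure lborel (F -` S \<inter> unit_square) = emeasure lborel (S \<inter> unit_square)"
begin

lemma L_mem: "k \<in> int_lattice \<Longrightarrow> L k \<in> int_lattice"
  using L_lattice by blast

lemma periodic_vimage: "periodic S \<Longrightarrow> periodic (F -` S)"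
  unfolding periodic_def[of "F -` S"] by (simp add: equivariant periodic_iff L_mem)

lemma open_vimage: "open S \<Longrightarrow> open (F -` S)"
  using cont by (simp add: open_vimage)

lemma open_image: "open S \<Longrightarrow> open (F ` S)"
  using continuous_on_subset[OF cont, of S] inj_on_subset[of F UNIV S] bij
  by (simp add: invariance_of_domain bij_def)

lemma homeomorphism_invariant:
  assumes "F -` U = U"
  shows "homeomorphism U U F (inv F)"
proof -
  have "inj F" "surj F"
    using bij by (auto simp: bij_def)
  moreover have "continuous_on UNIV (inv F)"
    unfolding continuous_on_open_vimage[OF open_UNIV]
    using open_image bij by (auto simp: bij_vimage_eq_inv_image bij_imp_bij_inv inv_inv_eq)
  moreover have "F ` U = U"
    using assms \<open>surj F\<close> by (metis surj_image_vimage_eq)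
  moreover have "inv F ` U = U"
    using assms by (metis bij bij_vimage_eq_inv_image)
  ultimately show ?thesis
    using cont unfolding homeomorphism_def
    by (auto intro: continuous_on_subset simp: surj_f_inv_f)
qed

text \<open>Positivity of \<open>n\<close> keeps \<open>L_nonsurj\<close>: the image of the lattice
  under a positive power lies in its image under \<open>L\<close>, whereas the zeroth power is
  onto.\<close>

lemma funpow_torus_lift:
  assumes "0 < n"
  shows "torus_lift (F ^^ n) (L ^^ n)"
proof (rule torus_lift.intro)
  show "continuous_on UNIV (F ^^ n)"
  proof (induction n)
    case (Suc n)
    then show ?case
      using continuous_on_compose2[OF cont Suc] by (simp add: o_def)
  qed (simp add: id_def)
  show "bij (F ^^ n)"
    using bij by (rule bij_betw_funpow)
  show "linear (L ^^ n)"
  proof (induction n)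
    case 0
    show ?case
      unfolding funpow.simps by (rule linear_id)
  next
    case (Suc n)
    show ?case
      unfolding funpow.simps by (rule linear_compose[OF Suc linear_L])
  qed
  have mem: "(L ^^ n) k \<in> int_lattice" if "k \<in> int_lattice" for k n
    by (induction n) (simp_all add: L_mem that)
  then show "(L ^^ n) ` int_lattice \<subseteq> int_lattice"
    by blast
  obtain m where m: "n = Suc m"
    using assms gr0_implies_Suc by blast
  show "\<not> int_lattice \<subseteq> (L ^^ n) ` int_lattice"
  proof
    assume *: "int_lattice \<subseteq> (L ^^ n) ` int_lattice"
    have "k \<in> L ` int_lattice" if "k \<in> int_lattice" for k
    proof -
      obtain l where "l \<in> int_lattice" "k = L ((L ^^ m) l)"
        using * \<open>k \<in> int_lattice\<close> unfolding m funpow.simps comp_def by blast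
      then show ?thesis
        using mem by blast
    qed
    then show False
      using L_nonsurj by blast
  qed
  show "(F ^^ n) (x + k) = (F ^^ n) x + (L ^^ n) k" if "k \<in> int_lattice" for x k
    by (induction n) (simp_all add: equivariant mem that)
  show "emeasure lborel ((F ^^ n) -` S \<inter> unit_square) = emeasure lborel (S \<inter> unit_square)"
    if S: "open S" "periodic S" for S
  proof -
    have "open ((F ^^ n) -` S) \<and> periodic ((F ^^ n) -` S) \<and>
      emeasure lborel ((F ^^ n) -` S \<inter> unit_square) = emeasure lborel (S \<inter> unit_square)"
    proof (induction n)
      case 0
      then show ?case
        using S by simp
    next
      case (Suc n)
      then show ?case
        using open_vimage periodic_vimage preserving unfolding funpow_Suc_vimage by metis
    qed
    then show ?thesis
      by blast
  qed
qed

lemma open_funpow_vimage: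
  assumes "open S"
  shows "open ((F ^^ n) -` S)"
proof (induction n)
  case (Suc n)
  then show ?case
    unfolding funpow_Suc_vimage by (rule open_vimage)
qed (simp add: assms)

lemma emeasure_funpow_vimage:
  assumes "open S" "periodic S"
  shows "emeasure lborel ((F ^^ n) -` S \<inter> unit_square) = emeasure lborel (S \<inter> unit_square)"
proof (cases "n = 0")
  case False
  then show ?thesis
    using torus_lift.preserving[OF funpow_torus_lift, OF _ assms] by blast
qed simp

text \<open>Poincare recurrence: without a return the iterated preimages of \<open>S\<close> would
  be infinitely many disjoint sets of equal positive area in a square of area one.\<close>

lemma recurrent:
  assumes S: "open S" "periodic S" "S \<noteq> {}"
  shows "\<exists>n>0. \<exists>x\<in>S. (F ^^ n) x \<in> S"
proof (rule ccontr)
  assume no: "\<not> ?thesis"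
  define A where "A = (\<lambda>n. (F ^^ n) -` S \<inter> unit_square)"
  have disj: "A i \<inter> A j = {}" if "i < j" for i j
  proof -
    have False if "(F ^^ i) x \<in> S" "(F ^^ j) x \<in> S" for x
    proof -
      have "(F ^^ (j - i)) ((F ^^ i) x) \<in> S"
        using that \<open>i < j\<close> by (metis add.commute comp_apply funpow_add le_add_diff_inverse less_imp_le)
      then show False
        using no that(1) \<open>i < j\<close> zero_less_diff by blast
    qed
    then show ?thesis
      unfolding A_def by blast
  qed
  then have "disjoint_family A"
    unfolding disjoint_family_on_def by (metis inf_commute linorder_neqE_nat)
  moreover have "range A \<subseteq> sets lborel"
    using unit_square_Int_sets[OF open_funpow_vimage[OF S(1)]] by (auto simp: A_def)
  ultimately have "(\<Sum>n. emeasure lborel (A n)) = emeasure lborel (\<Union>n. A n)"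
    by (rule suminf_emeasure[rotated])
  also have "\<dots> \<le> emeasure lborel unit_square"
    using unit_square_Int_sets[OF open_UNIV] by (intro emeasure_mono) (auto simp: A_def)
  finally have le: "(\<Sum>n. emeasure lborel (A n)) \<le> 1"
    by (simp add: emeasure_unit_square)
  have eq: "emeasure lborel (A n) = emeasure lborel (S \<inter> unit_square)" for n
    using emeasure_funpow_vimage[OF S(1,2)] by (simp add: A_def)
  have "emeasure lborel (S \<inter> unit_square) = 0"
  proof (rule ccontr)
    assume "emeasure lborel (S \<inter> unit_square) \<noteq> 0"
    then obtain c where c: "emeasure lborel (S \<inter> unit_square) = ennreal c" "0 < c"
      using emeasure_unit_square_less_top[of S]
      by (cases "emeasure lborel (S \<inter> unit_square)") (auto simp: less_le)
    have "(\<Sum>n. emeasure lborel (A n)) = (\<Sum>n::nat. ennreal c)"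
      by (simp only: eq c(1))
    also have "\<dots> = top"
      using c(2) by (intro summable_iff_suminf_neq_top) (auto simp: summable_const_iff)
    finally show False
      using le by (simp add: top_unique)
  qed
  then show False
    using periodic_open_null_imp_empty S by blast
qed

text \<open>Let \<open>C\<close> be the component of \<open>x0\<close>. By \<open>ret\<close> and
  equivariance, \<open>F\<close> sends each translate \<open>C + k\<close> into
  \<open>C + j + L k\<close>. So \<open>L\<close> describes how translates of \<open>C\<close> are
  permuted, and the stabiliser \<open>H\<close> of \<open>C\<close> falls under the algebraic
  dichotomy: full rank gives periods of \<open>C\<close> in both directions, and otherwise there is
  an eigenvalue.\<close>

lemma invariant_component_dichotomy:
  assumes U: "open U" "periodic U" "F -` U = U"
    and kl: "k0 \<in> int_lattice" "l0 \<in> int_lattice"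
    and ret: "connected_component U (F (x0 + k0)) (x0 + l0)"
  shows "(\<exists>m>0. \<forall>z. (connected_component U x0 (z + (m, 0)) \<longleftrightarrow> connected_component U x0 z) \<and>
                   (connected_component U x0 (z + (0, m)) \<longleftrightarrow> connected_component U x0 z)) \<or>
         (\<exists>w \<mu>. w \<noteq> 0 \<and> \<bar>\<mu>\<bar> = 1 \<and> (\<forall>x. w \<bullet> L x = \<mu> * (w \<bullet> x)))"
proof -
  define R where "R = connected_component U"
  have sym: "R x y \<Longrightarrow> R y x" and trans: "R x y \<Longrightarrow> R y z \<Longrightarrow> R x z" and inU: "R x y \<Longrightarrow> y \<in> U" for x y z
    unfolding R_def by (auto intro: connected_component_sym connected_component_trans
        dest: connected_component_in)
  have refl: "R x x" if "x \<in> U" for x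
    using that by (simp add: R_def)
  have R_add: "R (x + k) (y + k) \<longleftrightarrow> R x y" if "k \<in> int_lattice" for x y k
    unfolding R_def by (rule connected_component_add_lattice[OF U(2) that])
  have R_F: "R (F x) (F y) \<longleftrightarrow> R x y" for x y
    using connected_component_homeomorphism_iff[OF homeomorphism_invariant[OF U(3)], of x y] U(3)
    unfolding R_def by (metis connected_component_in vimage_eq)
  \<comment> \<open>Chosen so that \<open>F\<close> maps the component of \<open>x0\<close> into
    that of \<open>x0 + j\<close>.\<close>
  define j where "j = l0 - L k0"
  have j: "j \<in> int_lattice"
    using kl L_mem int_lattice_diff by (simp add: j_def)
  have shift: "R (F x0 + L k) (x0 + j + L k)" if k: "k \<in> int_lattice" for k
  proof -
    have "R (F x0 + L k0) (x0 + j + L k0)"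
      using ret kl(1) by (simp add: R_def j_def equivariant)
    then show ?thesis
      using R_add L_mem kl(1) k by metis
  qed
  define H where "H = {k \<in> int_lattice. R x0 (x0 + k)}"
  have "R x0 x0"
    using ret kl(1) R_F R_def by (metis R_add connected_component_refl_eq connected_component_in U(3) vimage_eq)
  then have H0: "0 \<in> H"
    by (simp add: H_def int_lattice_zero)
  have H_shift: "R x0 (z + k) \<longleftrightarrow> R x0 z" if "k \<in> H" for k z
    using that R_add[of k x0 z] sym trans unfolding H_def by blast
  have H_add: "k + l \<in> H" if "k \<in> H" "l \<in> H" for k l
    using that H_shift[of l "x0 + k"] int_lattice_add by (auto simp: H_def add.assoc)
  have H_uminus: "- k \<in> H" if "k \<in> H" for k
    using that H_shift[of k "x0 - k"] int_lattice_uminus \<open>R x0 x0\<close> by (auto simp: H_def)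
  \<comment> \<open>If \<open>C + k = C\<close>, applying \<open>F\<close> gives
    \<open>C + j + L k = C + j\<close>.\<close>
  have "L k \<in> H" if "k \<in> H" for k
  proof -
    have k: "k \<in> int_lattice" "R x0 (x0 + k)"
      using that by (auto simp: H_def)
    then have "R (F x0) (F x0 + L k)"
      using R_F equivariant by metis
    moreover have "R (F x0) (x0 + j)"
      using shift[of 0] linear_0[OF linear_L] H0 by (simp add: H_def)
    ultimately have "R (x0 + j) (x0 + j + L k)"
      using shift[OF k(1)] sym trans by blast
    then have "R (x0 + j) (x0 + L k + j)"
      by (simp add: ac_simps)
    then show ?thesis
      using R_add[OF j] L_mem k(1) by (simp add: H_def)
  qed
  then have LH: "L ` H \<subseteq> H"
    by blast
  define P where "P = {y. \<exists>k\<in>int_lattice. R (x0 + k) y}"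
  have P_orbit: "P = component_orbit U x0"
    by (simp add: P_def component_orbit_def R_def)
  have "open P" "periodic P"
    unfolding P_orbit using U(1,2) by (auto intro: open_component_orbit periodic_component_orbit)
  have P_R: "z \<in> P \<longleftrightarrow> y \<in> P" if "R y z" for y z
    using that sym trans unfolding P_def by blast
  have PU: "P \<subseteq> U"
    using inU unfolding P_def by blast
  have openR: "open {z. R y z}" for y
    unfolding R_def by (rule open_connected_component[OF U(1)])
  have "P \<subseteq> F -` P"
  proof
    fix y assume "y \<in> P"
    then obtain k where k: "k \<in> int_lattice" "R (x0 + k) y"
      by (auto simp: P_def)
    then have "R (F x0 + L k) (F y)"
      using R_F equivariant by metis
    then have "R (x0 + (j + L k)) (F y)"
      using shift[OF k(1)] sym trans by (metis add.assoc)
    then show "y \<in> F -` P"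
      using int_lattice_add[OF j L_mem[OF k(1)]] by (auto simp: P_def)
  qed
  \<comment> \<open>Both sets have the same measure, and their difference is a union of components.\<close>
  have "F -` P - P = {}"
  proof (rule periodic_open_null_imp_empty)
    have "\<exists>T. open T \<and> y \<in> T \<and> T \<subseteq> F -` P - P" if y: "y \<in> F -` P - P" for y
    proof (intro exI[of _ "{z. R y z}"] conjI)
      show "y \<in> {z. R y z}"
        using y PU U(3) refl by blast
      show "{z. R y z} \<subseteq> F -` P - P"
        using y P_R R_F by blast
    qed (rule openR)
    then show "open (F -` P - P)"
      by (subst open_subopen) blast
    show "periodic (F -` P - P)"
      using \<open>periodic P\<close> periodic_vimage periodic_Diff by blast
    have "emeasure lborel ((F -` P - P) \<inter> unit_square) =
        emeasure lborel (F -` P \<inter> unit_square - P \<inter> unit_square)"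
      by (rule arg_cong[where f = "emeasure lborel"]) blast
    also have "\<dots> = emeasure lborel (F -` P \<inter> unit_square) - emeasure lborel (P \<inter> unit_square)"
    proof (rule emeasure_Diff)
      show "emeasure lborel (P \<inter> unit_square) \<noteq> \<infinity>"
        using emeasure_unit_square_less_top[of P] by simp
      show "F -` P \<inter> unit_square \<in> sets lborel" "P \<inter> unit_square \<in> sets lborel"
        using \<open>open P\<close> open_vimage unit_square_Int_sets by blast+
      show "P \<inter> unit_square \<subseteq> F -` P \<inter> unit_square"
        using \<open>P \<subseteq> F -` P\<close> by blast
    qed
    also have "\<dots> = 0"
      using preserving[OF \<open>open P\<close> \<open>periodic P\<close>] emeasure_unit_square_less_top[of P]
      by (simp add: diff_eq_0_iff_ennreal)
    finally show "emeasure lborel ((F -` P - P) \<inter> unit_square) = 0" .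
  qed
  \<comment> \<open>The preimage of \<open>x0 + m + j\<close> lies in a translate
    \<open>C + k\<close>, as \<open>P\<close> is its own preimage. Then \<open>C + j + L k\<close>
    is the component of \<open>x0 + m + j\<close>, so \<open>m - L k\<close> stabilises
    \<open>C\<close>.\<close>
  have cover: "\<exists>k\<in>int_lattice. m - L k \<in> H" if m: "m \<in> int_lattice" for m
  proof -
    obtain y where y: "F y = x0 + (m + j)"
      using bij by (metis bij_pointE)
    have mj: "m + j \<in> int_lattice"
      using int_lattice_add[OF m j] .
    have "x0 + (m + j) \<in> U"
      using periodic_iff[OF U(2) mj] inU[OF \<open>R x0 x0\<close>] by blast
    then have "F y \<in> P"
      unfolding P_def y using refl mj by blast
    then have "y \<in> P"
      using \<open>F -` P - P = {}\<close> by blast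
    then obtain k where k: "k \<in> int_lattice" "R (x0 + k) y"
      by (auto simp: P_def)
    then have "R (F x0 + L k) (x0 + (m + j))"
      using R_F equivariant y by metis
    then have "R (x0 + j + L k) (x0 + (m + j))"
      using shift[OF k(1)] sym trans by blast
    then have "R (x0 + (j + L k)) (x0 + (m - L k) + (j + L k))"
      by (simp add: algebra_simps)
    then have "R x0 (x0 + (m - L k))"
      using R_add[OF int_lattice_add[OF j L_mem[OF k(1)]]] by blast
    then show ?thesis
      using k(1) int_lattice_diff[OF m L_mem[OF k(1)]] by (auto simp: H_def)
  qed
  have "H \<subseteq> int_lattice"
    by (auto simp: H_def)
  from invariant_subgroup_full_rank_or_eigenvalue[OF this H0 H_add H_uminus linear_L L_lattice LH cover L_nonsurj]
  consider (full) m :: int where "m \<noteq> 0" "(of_int m, 0) \<in> H" "(0, of_int m) \<in> H" |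
    (eigen) "\<exists>w \<mu>. w \<noteq> 0 \<and> \<bar>\<mu>\<bar> = 1 \<and> (\<forall>x. w \<bullet> L x = \<mu> * (w \<bullet> x))"
    by blast
  then show ?thesis
  proof cases
    case full
    have "(\<bar>of_int m\<bar>, 0) \<in> H" "(0, \<bar>of_int m\<bar>) \<in> H"
      using full(2,3) H_uminus[OF full(2)] H_uminus[OF full(3)] by (auto simp: abs_if)
    then have "\<forall>z. (R x0 (z + (\<bar>of_int m\<bar>, 0)) \<longleftrightarrow> R x0 z) \<and> (R x0 (z + (0, \<bar>of_int m\<bar>)) \<longleftrightarrow> R x0 z)"
      using H_shift by blast
    moreover have "0 < \<bar>real_of_int m\<bar>"
      using full(1) by simp
    ultimately show ?thesis
      unfolding R_def by blast
  qed blast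
qed

lemma funpow_vimage_invariant:
  assumes "F -` U = U"
  shows "(F ^^ n) -` U = U"
proof (induction n)
  case (Suc n)
  then show ?case
    unfolding funpow_Suc_vimage using assms by simp
qed simp

text \<open>Recurrence supplies an iterate for which some component of \<open>U\<close> returns to a
  translate of itself. The periodic component is unaffected by passing to the iterate, and an
  eigenvalue of the power of \<open>L\<close> is brought back to \<open>L\<close>.\<close>

lemma invariant_set_dichotomy:
  assumes U: "open U" "periodic U" "F -` U = U" "U \<noteq> {}"
  shows "(\<exists>C m. C \<subseteq> U \<and> open C \<and> connected C \<and> C \<noteq> {} \<and> 0 < m \<and>
            (\<forall>z. (z + (m, 0) \<in> C \<longleftrightarrow> z \<in> C) \<and> (z + (0, m) \<in> C \<longleftrightarrow> z \<in> C))) \<or>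
         (\<exists>w c. w \<noteq> 0 \<and> \<bar>c\<bar> = 1 \<and> (\<forall>x. w \<bullet> L x = c * (w \<bullet> x)))"
proof -
  obtain x0 where x0: "x0 \<in> U"
    using U(4) by blast
  have "connected_component U (x0 + 0) x0"
    using x0 by simp
  then have "x0 \<in> component_orbit U x0"
    unfolding component_orbit_def using int_lattice_zero by blast
  \<comment> \<open>Recurrence is a statement about periodic sets, so it yields a return of the
    component only up to lattice translation; \<open>k\<close> and \<open>l\<close> record the
    translates.\<close>
  then obtain n y where n: "0 < n" and y: "y \<in> component_orbit U x0" "(F ^^ n) y \<in> component_orbit U x0"
    using recurrent[OF open_component_orbit[OF U(1)] periodic_component_orbit[OF U(2)]] by blast
  then obtain k l where kl: "k \<in> int_lattice" "l \<in> int_lattice"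
    and ky: "connected_component U (x0 + k) y" and ly: "connected_component U (x0 + l) ((F ^^ n) y)"
    by (auto simp: component_orbit_def)
  interpret Fn: torus_lift "F ^^ n" "L ^^ n"
    using funpow_torus_lift[OF n] .
  have inv: "(F ^^ n) -` U = U"
    using funpow_vimage_invariant[OF U(3)] .
  have "connected_component U ((F ^^ n) (x0 + k)) ((F ^^ n) y)"
    using connected_component_homeomorphismI[OF Fn.homeomorphism_invariant[OF inv] ky] .
  then have ret: "connected_component U ((F ^^ n) (x0 + k)) (x0 + l)"
    using ly connected_component_sym connected_component_trans by metis
  from Fn.invariant_component_dichotomy[OF U(1,2) inv kl ret]
  consider (full) m where "0 < m" "\<forall>z. (connected_component U x0 (z + (m, 0)) \<longleftrightarrow> connected_component U x0 z) \<and>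
                   (connected_component U x0 (z + (0, m)) \<longleftrightarrow> connected_component U x0 z)" |
    (eigen) w \<mu> where "w \<noteq> 0" "\<bar>\<mu>\<bar> = 1" "\<And>x. w \<bullet> (L ^^ n) x = \<mu> * (w \<bullet> x)"
    by blast
  then show ?thesis
  proof cases
    case full
    moreover have "connected_component_set U x0 \<noteq> {}"
      unfolding connected_component_eq_empty using x0 by blast
    ultimately show ?thesis
      using open_connected_component[OF U(1), of x0] connected_component_subset[of U x0]
      by (intro disjI1 exI[of _ "connected_component_set U x0"] exI[of _ m] conjI)
        (simp_all only: mem_Collect_eq connected_connected_component simp_thms)
  next
    case eigen
    obtain c where "\<bar>c\<bar> = 1" "\<forall>x. w \<bullet> L x = c * (w \<bullet> x)"
      using left_eigenvalue_of_funpow[OF linear_L L_lattice L_nonsurj n eigen] by blast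
    then show ?thesis
      using eigen(1) by (intro disjI2 exI[of _ w] exI[of _ c] conjI)
  qed
qed

lemma disjoint_invariant_sets_imp_eigenvalue:
  assumes U: "open U" "periodic U" "F -` U = U" "U \<noteq> {}"
    and V: "open V" "periodic V" "F -` V = V" "V \<noteq> {}"
    and "U \<inter> V = {}"
  shows "\<exists>w c. w \<noteq> 0 \<and> \<bar>c\<bar> = 1 \<and> (\<forall>x. w \<bullet> L x = c * (w \<bullet> x))"
proof (rule ccontr)
  assume no: "\<not> ?thesis"
  obtain C m where C: "C \<subseteq> U" "open C" "connected C" "C \<noteq> {}" "0 < m" "\<And>z. z + (m, 0) \<in> C \<longleftrightarrow> z \<in> C"
    using invariant_set_dichotomy[OF U] no by blast
  obtain D n where D: "D \<subseteq> V" "open D" "connected D" "D \<noteq> {}" "0 < n" "\<And>z. z + (0, n) \<in> D \<longleftrightarrow> z \<in> D"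
    using invariant_set_dichotomy[OF V] no by blast
  have "C \<inter> D \<noteq> {}"
    using periodic_domains_intersect[OF C(2-6) D(2-6)] .
  then show False
    using C(1) D(1) \<open>U \<inter> V = {}\<close> by blast
qed

text \<open>The nontrivial inclusion holds because \<open>F\<close> is an open map.\<close>

lemma vimage_closure: "F -` closure S = closure (F -` S)"
proof
  show "closure (F -` S) \<subseteq> F -` closure S"
    using cont closure_subset by (intro closure_minimal closed_vimage) auto
  show "F -` closure S \<subseteq> closure (F -` S)"
  proof
    fix x assume x: "x \<in> F -` closure S"
    show "x \<in> closure (F -` S)"
      unfolding closure_iff_nhds_not_empty
    proof (intro allI impI)
      fix A N assume "N \<subseteq> A" "open N" "x \<in> N"
      then have "F ` N \<inter> S \<noteq> {}"
        using x open_image[of N] open_Int_closure_eq_empty[of "F ` N" S] by blast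
      then show "F -` S \<inter> A \<noteq> {}"
        using \<open>N \<subseteq> A\<close> by blast
    qed
  qed
qed

lemma vimage_interior: "F -` interior S = interior (F -` S)"
  using vimage_closure[of "- S"] by (simp add: interior_closure vimage_Compl)

text \<open>\<open>W\<close> minus the closure of its preimage is open, periodic and, by equality of
  areas, null; hence empty. So \<open>W\<close> and its preimage have the same closure, and exact
  invariance is gained on taking closures.\<close>

lemma not_dense_imp_eigenvalue:
  assumes W: "open W" "periodic W" "F -` W \<subseteq> W" "W \<noteq> {}" and "closure W \<noteq> UNIV"
  shows "\<exists>w c. w \<noteq> 0 \<and> \<bar>c\<bar> = 1 \<and> (\<forall>x. w \<bullet> L x = c * (w \<bullet> x))"
proof -
  have "W - closure (F -` W) = {}"
  proof (rule periodic_open_null_imp_empty)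
    show "open (W - closure (F -` W))"
      using W(1) by (intro open_Diff closed_closure)
    show "periodic (W - closure (F -` W))"
      using W(2) by (intro periodic_Diff periodic_closure periodic_vimage)
    have meas: "W \<inter> unit_square \<in> sets lborel" "F -` W \<inter> unit_square \<in> sets lborel"
      using W(1) open_vimage unit_square_Int_sets by blast+
    have fin: "emeasure lborel (F -` W \<inter> unit_square) \<noteq> \<infinity>"
      using emeasure_unit_square_less_top[of "F -` W"] by simp
    have "emeasure lborel ((W - closure (F -` W)) \<inter> unit_square) \<le>
        emeasure lborel (W \<inter> unit_square - F -` W \<inter> unit_square)"
      using meas closure_subset[of "F -` W"] by (intro emeasure_mono) auto
    also have "\<dots> = emeasure lborel (W \<inter> unit_square) - emeasure lborel (F -` W \<inter> unit_square)"
      using W(3) meas fin by (intro emeasure_Diff) auto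
    also have "\<dots> = 0"
      using preserving[OF W(1,2)] emeasure_unit_square_less_top[of W]
      by (simp add: diff_eq_0_iff_ennreal)
    finally show "emeasure lborel ((W - closure (F -` W)) \<inter> unit_square) = 0"
      by simp
  qed
  then have "closure (F -` W) = closure W"
    using W(3) by (metis Diff_eq_empty_iff closure_closure closure_mono subset_antisym)
  then have inv: "F -` closure W = closure W"
    by (simp add: vimage_closure)
  show ?thesis
  proof (rule disjoint_invariant_sets_imp_eigenvalue)
    show "F -` interior (closure W) = interior (closure W)"
      by (simp add: vimage_interior inv)
    show "F -` (- closure W) = - closure W"
      by (simp add: vimage_Compl inv)
    show "interior (closure W) \<noteq> {}"
      using W(1,4) closure_subset interior_maximal by blast
    show "interior (closure W) \<inter> - closure W = {}"
      using interior_subset by blast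
    show "periodic (interior (closure W))" "periodic (- closure W)"
      using W(2) by (simp_all add: periodic_interior periodic_closure periodic_Compl)
    show "- closure W \<noteq> {}"
      using assms(5) by blast
  qed (simp_all add: open_Compl)
qed

text \<open>If every nonempty open set were met, up to lattice translation, by a dense set of
  orbits, Baire's theorem over a countable basis would give one point whose orbit meets them
  all.\<close>

lemma eigenvalue_or_dense_orbit:
  "(\<exists>w c. w \<noteq> 0 \<and> \<bar>c\<bar> = 1 \<and> (\<forall>x. w \<bullet> L x = c * (w \<bullet> x))) \<or>
   (\<exists>x. closure {(F ^^ n) x + k | n k. k \<in> int_lattice} = UNIV)"
proof (rule disjCI)
  assume no_dense: "\<nexists>x. closure {(F ^^ n) x + k | n k. k \<in> int_lattice} = UNIV"
  define W where "W = (\<lambda>b. {z. \<exists>n. \<exists>k\<in>int_lattice. (F ^^ n) z + k \<in> b})"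
  have W_I: "z \<in> W b" if "k \<in> int_lattice" "(F ^^ n) z + k \<in> b" for z b n k
    unfolding W_def using that by (intro CollectI exI[of _ n] bexI[of _ k])
  have openW: "open (W b)" if "open b" for b
  proof -
    have "W b = (\<Union>n. (F ^^ n) -` (\<Union>k\<in>int_lattice. (\<lambda>z. z + k) -` b))"
      by (rule set_eqI) (simp add: W_def)
    moreover have "open ((\<lambda>z. z + k) -` b)" for k
      using that by (intro Topological_Spaces.open_vimage continuous_intros)
    ultimately show ?thesis
      by (simp add: open_UN open_funpow_vimage)
  qed
  have "\<exists>b. open b \<and> b \<noteq> {} \<and> closure (W b) \<noteq> UNIV"
  proof (rule ccontr)
    assume *: "\<not> ?thesis"
    obtain \<B> :: "(real \<times> real) set set" where \<B>: "countable \<B>" "topological_basis \<B>"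
      using ex_countable_basis by blast
    have "UNIV \<subseteq> closure (\<Inter>(W ` (\<B> - {{}})))"
    proof (rule Baire)
      show "openin (top_of_set UNIV) T \<and> UNIV \<subseteq> closure T" if "T \<in> W ` (\<B> - {{}})" for T
        using that * openW topological_basis_open[OF \<B>(2)] by auto
    qed (use \<B> in auto)
    then have "\<Inter>(W ` (\<B> - {{}})) \<noteq> {}"
      using closure_empty by (metis UNIV_not_empty subset_empty)
    then obtain x where x: "\<And>b. b \<in> \<B> \<Longrightarrow> b \<noteq> {} \<Longrightarrow> x \<in> W b"
      by blast
    have "y \<in> closure {(F ^^ n) x + k | n k. k \<in> int_lattice}" for y
      unfolding closure_iff_nhds_not_empty
    proof (intro allI impI)
      fix A N assume "N \<subseteq> A" "open N" "y \<in> N"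
      then obtain b where "b \<in> \<B>" "y \<in> b" "b \<subseteq> N"
        using topological_basisE[OF \<B>(2)] by metis
      then obtain n k where "k \<in> int_lattice" "(F ^^ n) x + k \<in> b"
        using x W_def by blast
      then show "{(F ^^ n) x + k | n k. k \<in> int_lattice} \<inter> A \<noteq> {}"
        using \<open>b \<subseteq> N\<close> \<open>N \<subseteq> A\<close> by blast
    qed
    then show False
      using no_dense by blast
  qed
  then obtain b where b: "open b" "b \<noteq> {}" "closure (W b) \<noteq> UNIV"
    by blast
  show "\<exists>w c. w \<noteq> 0 \<and> \<bar>c\<bar> = 1 \<and> (\<forall>x. w \<bullet> L x = c * (w \<bullet> x))"
  proof (rule not_dense_imp_eigenvalue[OF openW[OF b(1)]])
    show "periodic (W b)"
      unfolding periodic_def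
    proof (intro ballI)
      fix z l assume "z \<in> W b" and l: "l \<in> int_lattice"
      then obtain n k where nk: "k \<in> int_lattice" "(F ^^ n) z + k \<in> b"
        by (auto simp: W_def)
      \<comment> \<open>The shift by \<open>l\<close> displaces the n-th image by a lattice vector,
        which is absorbed in \<open>k\<close>. For \<open>n = 0\<close> it is \<open>l\<close>
        itself, a case outside the lemma on iterates.\<close>
      define l' where "l' = (F ^^ n) (z + l) - (F ^^ n) z"
      have "l' \<in> int_lattice"
      proof (cases "n = 0")
        case False
        then interpret Fn: torus_lift "F ^^ n" "L ^^ n"
          using funpow_torus_lift by blast
        show ?thesis
          using Fn.equivariant[OF l] Fn.L_mem[OF l] by (simp add: l'_def)
      qed (use l in \<open>simp add: l'_def\<close>)
      then have "k - l' \<in> int_lattice"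
        using nk(1) int_lattice_diff by blast
      moreover have eq: "(F ^^ n) (z + l) + (k - l') = (F ^^ n) z + k"
        by (simp add: l'_def)
      have "(F ^^ n) (z + l) + (k - l') \<in> b"
        unfolding eq by (rule nk(2))
      ultimately show "z + l \<in> W b"
        by (rule W_I)
    qed
    show "F -` W b \<subseteq> W b"
    proof
      fix z assume "z \<in> F -` W b"
      then have "F z \<in> W b"
        by simp
      then obtain n k where k: "k \<in> int_lattice" and "(F ^^ n) (F z) + k \<in> b"
        by (auto simp: W_def)
      then have "(F ^^ Suc n) z + k \<in> b"
        by (simp add: funpow_swap1)
      then show "z \<in> W b"
        by (rule W_I[OF k])
    qed
    show "W b \<noteq> {}"
    proof -
      obtain z where "z \<in> b"
        using b(2) by blast
      then have "(F ^^ 0) z + 0 \<in> b"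
        by simp
      then have "z \<in> W b"
        by (rule W_I[OF int_lattice_zero])
      then show ?thesis
        by blast
    qed
  qed (rule b(3))
qed

end

section \<open>Lifting torus maps\<close>

lemma cis_2pi_eq_iff: "cis (2 * pi * s) = cis (2 * pi * t) \<longleftrightarrow> s - t \<in> \<int>"
proof -
  have "cis (2 * pi * s) = cis (2 * pi * t) \<longleftrightarrow> (\<exists>n::int. 2 * pi * s = 2 * pi * t + 2 * pi * n)"
    unfolding sin_cos_eq_iff[symmetric] by (auto simp: complex_eq_iff)
  also have "\<dots> \<longleftrightarrow> (\<exists>n::int. s - t = n)"
  proof -
    have "2 * pi * s = 2 * pi * t + 2 * pi * n \<longleftrightarrow> s - t = n" for n :: real
    proof -
      have "2 * pi * s = 2 * pi * t + 2 * pi * n \<longleftrightarrow> (2 * pi) * s = (2 * pi) * (t + n)"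
        by (simp add: algebra_simps)
      also have "\<dots> \<longleftrightarrow> s = t + n"
        by (subst mult_cancel_left) simp
      finally show ?thesis
        by auto
    qed
    then show ?thesis
      by simp
  qed
  finally show ?thesis
    by (auto simp: Ints_def)
qed

lemma torus_proj_eq_iff: "torus_proj x = torus_proj y \<longleftrightarrow> x - y \<in> int_lattice"
  by (cases x; cases y) (simp add: torus_proj_def cis_2pi_eq_iff int_lattice_def)

lemma torus_proj_add_lattice: "k \<in> int_lattice \<Longrightarrow> torus_proj (x + k) = torus_proj x"
  by (simp add: torus_proj_eq_iff)

lemma torus_proj_add:
  "torus_proj (x + y) = (fst (torus_proj x) * fst (torus_proj y), snd (torus_proj x) * snd (torus_proj y))"
  by (cases x; cases y) (simp add: torus_proj_def cis_mult algebra_simps)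

lemma torus_proj_mem: "torus_proj x \<in> torus"
  by (cases x) (simp add: torus_proj_def torus_def)

lemma torusE:
  assumes "z \<in> torus"
  obtains x where "z = torus_proj x"
proof -
  have "z = torus_proj (Arg (fst z) / (2 * pi), Arg (snd z) / (2 * pi))"
  proof -
    have "a = cis (Arg a)" if "cmod a = 1" for a
    proof -
      have "a \<noteq> 0"
        using that by auto
      then show ?thesis
        using that by (simp add: cis_Arg sgn_div_norm)
    qed
    then show ?thesis
      using assms by (cases z) (simp add: torus_def torus_proj_def)
  qed
  then show thesis
    using that by blast
qed

lemma continuous_on_torus_proj: "continuous_on S torus_proj"
  unfolding torus_proj_def split_def by (intro continuous_intros)

lemma torus_proj_image_unit_square: "torus_proj ` unit_square = torus"
proof
  show "torus \<subseteq> torus_proj ` unit_square"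
  proof
    fix z assume "z \<in> torus"
    then obtain x where x: "z = torus_proj x"
      by (rule torusE)
    obtain k where k: "k \<in> int_lattice" "x + k \<in> unit_square"
      using ex_lattice_translate_unit_square[of x] by (rule bexE)
    have "z = torus_proj (x + k)"
      by (simp add: x torus_proj_add_lattice[OF k(1)])
    then show "z \<in> torus_proj ` unit_square"
      using k(2) by (rule image_eqI)
  qed
qed (use torus_proj_mem in blast)

lemma periodic_vimage_image:
  assumes "periodic S"
  shows "torus_proj -` (torus_proj ` S) = S"
proof -
  have "x \<in> S" if "torus_proj x = torus_proj y" "y \<in> S" for x y
    using periodic_iff[OF assms, of "x - y" y] that by (simp add: torus_proj_eq_iff)
  then show ?thesis
    by blast
qed

text \<open>The image of the complement is already the image of its compact part in the unit square,
  hence closed, and periodicity makes it disjoint from the image of \<open>S\<close>.\<close>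

lemma openin_torus_proj_image:
  assumes "open S" "periodic S"
  shows "openin (top_of_set torus) (torus_proj ` S)"
proof -
  have "torus_proj ` (- S) = torus_proj ` (- S \<inter> unit_square)"
  proof -
    have "torus_proj x \<in> torus_proj ` (- S \<inter> unit_square)" if x: "x \<in> - S" for x
    proof -
      obtain k where k: "k \<in> int_lattice" "x + k \<in> unit_square"
        using ex_lattice_translate_unit_square[of x] by (rule bexE)
      then have "x + k \<in> - S \<inter> unit_square"
        using x periodic_iff[OF assms(2) k(1)] by blast
      with torus_proj_add_lattice[OF k(1), symmetric] show ?thesis
        by (rule image_eqI)
    qed
    then show ?thesis
      by blast
  qed
  moreover have "compact (- S \<inter> unit_square)"
    using assms(1) by (intro closed_Int_compact compact_Times) auto
  ultimately have "closed (torus_proj ` (- S))"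
    using compact_continuous_image[OF continuous_on_torus_proj] compact_imp_closed by metis
  moreover have "torus_proj ` S = torus - torus_proj ` (- S)"
  proof -
    have neq: "torus_proj x \<noteq> torus_proj y" if "x \<in> S" "y \<in> - S" for x y
    proof
      assume "torus_proj x = torus_proj y"
      then have "y \<in> torus_proj -` (torus_proj ` S)"
        using that(1) by (simp add: image_iff) metis
      then show False
        using that(2) by (simp add: periodic_vimage_image[OF assms(2)])
    qed
    show ?thesis
    proof (intro equalityI subsetI)
      fix z assume "z \<in> torus_proj ` S"
      then obtain x where x: "x \<in> S" "z = torus_proj x"
        by (rule imageE)
      then show "z \<in> torus - torus_proj ` (- S)"
        using neq[OF x(1)] torus_proj_mem[of x] by (simp add: image_iff)
    next
      fix z assume z: "z \<in> torus - torus_proj ` (- S)"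
      then obtain x where "z = torus_proj x"
        using torusE by blast
      then show "z \<in> torus_proj ` S"
        using z by blast
    qed
  qed
  ultimately show ?thesis
    by (simp add: Diff_eq openin_open_Int open_Compl)
qed

section \<open>Area on the torus computed in the unit square\<close>

lemma sets_torus_measure: "sets torus_measure = sets (restrict_space borel torus)"
  by (simp add: torus_measure_def)

lemma space_torus_measure: "space torus_measure = torus"
  by (simp add: torus_measure_def space_restrict_space)

lemma emeasure_torus_measure:
  assumes "B \<in> sets torus_measure"
  shows "emeasure torus_measure B = emeasure lborel (torus_proj -` B \<inter> unit_square)"
proof -
  have usq: "unit_square \<in> sets lborel"
    using unit_square_Int_sets[OF open_UNIV] by simp
  have "torus_proj \<in> measurable (restrict_space lborel unit_square) (restrict_space borel torus)"
  proof (rule measurable_restrict_space2)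
    have "torus_proj \<in> borel_measurable borel"
      by (intro borel_measurable_continuous_onI continuous_on_torus_proj)
    then show "torus_proj \<in> borel_measurable (restrict_space lborel unit_square)"
      by (intro measurable_restrict_space1) simp
  qed (use torus_proj_mem in auto)
  then have "emeasure torus_measure B =
      emeasure (restrict_space lborel unit_square) (torus_proj -` B \<inter> space (restrict_space lborel unit_square))"
    unfolding torus_measure_def using assms by (intro emeasure_distr) (simp_all add: sets_torus_measure)
  also have "\<dots> = emeasure lborel (torus_proj -` B \<inter> unit_square)"
    using usq by (simp add: space_restrict_space emeasure_restrict_space)
  finally show ?thesis .
qed

section \<open>Lifts of continuous torus-valued maps\<close>

lemma circle_valued_lift:
  fixes g :: "'a::real_normed_vector \<Rightarrow> complex"
  assumes "continuous_on UNIV g" "\<And>x. cmod (g x) = 1"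
  shows "\<exists>\<theta>. continuous_on UNIV \<theta> \<and> (\<forall>x. g x = cis (2 * pi * \<theta> x))"
proof -
  have "g x \<noteq> 0" for x
    using assms(2)[of x] by auto
  then obtain h where h: "continuous_on UNIV h" "\<And>x. g x = exp (h x)"
    using continuous_logarithm_on_contractible[OF assms(1)] convex_imp_contractible[of UNIV]
    by (metis UNIV_I convex_UNIV)
  have "g x = cis (2 * pi * (Im (h x) / (2 * pi)))" for x
  proof -
    have "exp (Re (h x)) = 1"
      using assms(2)[of x] by (simp add: h(2))
    then show ?thesis
      by (simp add: h(2) exp_eq_polar)
  qed
  moreover have "continuous_on UNIV (\<lambda>x. Im (h x) / (2 * pi))"
    using h(1) by (intro continuous_intros) auto
  ultimately show ?thesis
    by blast
qed

lemma torus_valued_lift: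
  fixes g :: "'a::real_normed_vector \<Rightarrow> complex \<times> complex"
  assumes "continuous_on UNIV g" "\<And>x. g x \<in> torus"
  shows "\<exists>F. continuous_on UNIV F \<and> (\<forall>x. torus_proj (F x) = g x)"
proof -
  have "cmod (fst (g x)) = 1" "cmod (snd (g x)) = 1" for x
    using assms(2)[of x] by (auto simp: torus_def split: prod.splits)
  then obtain \<theta> \<phi> where \<theta>: "continuous_on UNIV \<theta>" "\<And>x. fst (g x) = cis (2 * pi * \<theta> x)"
    and \<phi>: "continuous_on UNIV \<phi>" "\<And>x. snd (g x) = cis (2 * pi * \<phi> x)"
    using circle_valued_lift[OF continuous_on_fst[OF assms(1)]]
      circle_valued_lift[OF continuous_on_snd[OF assms(1)]] by metis
  then show ?thesis
    by (intro exI[of _ "\<lambda>x. (\<theta> x, \<phi> x)"]) (auto intro!: continuous_intros simp: torus_proj_def prod_eq_iff)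
qed

lemma continuous_lattice_valued_constant:
  fixes g :: "'a::real_normed_vector \<Rightarrow> real \<times> real"
  assumes "continuous_on UNIV g" "\<And>x. g x \<in> int_lattice"
  shows "g x = g y"
proof -
  have const: "h constant_on UNIV" if h: "continuous_on UNIV h" "\<And>x. h x \<in> \<int>" for h :: "'a \<Rightarrow> real"
  proof (rule continuous_discrete_range_constant[OF connected_UNIV h(1)])
    fix x
    have "1 \<le> norm (h y - h x)" if "h y \<noteq> h x" for y
      using Ints_nonzero_abs_ge1[of "h y - h x"] h(2)[of x] h(2)[of y] that by simp
    then show "\<exists>e>0. \<forall>y. y \<in> UNIV \<and> h y \<noteq> h x \<longrightarrow> e \<le> norm (h y - h x)"
      using zero_less_one by blast
  qed
  have "fst (g x) \<in> \<int>" "snd (g x) \<in> \<int>" for x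
    using assms(2)[of x] by (auto simp: int_lattice_def mem_Times_iff)
  then have "(\<lambda>x. fst (g x)) constant_on UNIV" "(\<lambda>x. snd (g x)) constant_on UNIV"
    using const continuous_on_fst[OF assms(1)] continuous_on_snd[OF assms(1)] by blast+
  then show ?thesis
    by (auto simp: constant_on_def prod_eq_iff)
qed

lemma equivariant_scale_int:
  fixes F :: "'a::real_vector \<Rightarrow> 'b::real_vector"
  assumes "\<And>x. F (x + v) = F x + w"
  shows "F (x + of_int n *\<^sub>R v) = F x + of_int n *\<^sub>R w"
proof -
  have nat: "F (x + of_nat m *\<^sub>R v) = F x + of_nat m *\<^sub>R w" for m x
  proof (induction m)
    case (Suc m)
    have "F (x + of_nat (Suc m) *\<^sub>R v) = F ((x + of_nat m *\<^sub>R v) + v)"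
      by (simp add: algebra_simps)
    also have "\<dots> = F x + of_nat m *\<^sub>R w + w"
      by (simp only: assms Suc)
    finally show ?case
      by (simp add: algebra_simps)
  qed simp
  show ?thesis
  proof (cases n)
    case (nonneg m)
    then show ?thesis
      using nat by simp
  next
    case (neg m)
    then have n: "of_int n = - real (Suc m)"
      by simp
    show ?thesis
      using nat[of "x + of_int n *\<^sub>R v" "Suc m"] unfolding n by (simp add: algebra_simps)
  qed
qed

text \<open>Equivariance spreads bounds from the compact unit square over the plane, so the local
  injectivity radius and the size of image balls can be taken uniform; \<open>F\<close> is then a
  covering of the plane.\<close>

lemma equivariant_locally_injective_imp_bij:
  fixes F :: "real \<times> real \<Rightarrow> real \<times> real"
  assumes cont: "continuous_on UNIV F"
    and eqv: "\<And>x k. k \<in> int_lattice \<Longrightarrow> F (x + k) = F x + L k"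
    and linj: "\<And>x. \<exists>r>0. inj_on F (ball x r)"
  shows "bij F"
proof -
  have compactQ: "compact unit_square"
    by (intro compact_Times) auto
  obtain e where e: "0 < e" "\<And>x. x \<in> unit_square \<Longrightarrow> inj_on F (ball x e)"
  proof -
    define \<G> where "\<G> = {G. open G \<and> inj_on F G}"
    have "unit_square \<subseteq> \<Union>\<G>"
    proof
      fix x :: "real \<times> real"
      obtain r where "0 < r" "inj_on F (ball x r)"
        using linj by blast
      then show "x \<in> \<Union>\<G>"
        unfolding \<G>_def by (intro UnionI[of "ball x r"]) auto
    qed
    then obtain e where e: "0 < e" "\<And>x. x \<in> unit_square \<Longrightarrow> \<exists>G\<in>\<G>. ball x e \<subseteq> G"
      by (rule Heine_Borel_lemma[OF compactQ]) (auto simp: \<G>_def)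
    have "inj_on F (ball x e)" if x: "x \<in> unit_square" for x
    proof -
      obtain G where "G \<in> \<G>" "ball x e \<subseteq> G"
        using e(2)[OF x] by blast
      then show ?thesis
        unfolding \<G>_def using inj_on_subset by blast
    qed
    then show thesis
      using that e(1) by blast
  qed
  have inj: "inj_on F (ball x e)" for x
  proof (rule inj_onI)
    fix a b assume ab: "a \<in> ball x e" "b \<in> ball x e" "F a = F b"
    obtain k where k: "k \<in> int_lattice" "x + k \<in> unit_square"
      using ex_lattice_translate_unit_square[of x] by (rule bexE)
    have "a + k \<in> ball (x + k) e" "b + k \<in> ball (x + k) e" "F (a + k) = F (b + k)"
      using ab eqv[OF k(1)] by (simp_all add: dist_norm)
    then have "a + k = b + k"
      using e(2)[OF k(2)] unfolding inj_on_def by blast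
    then show "a = b"
      by simp
  qed
  \<comment> \<open>The least distance by which \<open>F\<close> separates a point from the sphere
    of radius \<open>e / 2\<close> around it. It is positive because that sphere lies inside the
    ball of radius \<open>e\<close> on which \<open>F\<close> is injective.\<close>
  obtain d where d: "0 < d" "\<And>x u. norm u = e / 2 \<Longrightarrow> d \<le> norm (F (x + u) - F x)"
  proof -
    define K where "K = unit_square \<times> sphere (0 :: real \<times> real) (e / 2)"
    have "compact K"
      unfolding K_def using compactQ by (intro compact_Times) auto
    moreover have "K \<noteq> {}"
      using e(1) by (simp add: K_def)
    moreover have "continuous_on K (\<lambda>(x, u). norm (F (x + u) - F x))"
      unfolding split_def
      using continuous_on_compose2[OF cont, of K "\<lambda>p. fst p + snd p"]
        continuous_on_compose2[OF cont, of K fst]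
      by (intro continuous_on_norm continuous_on_diff) (simp_all add: continuous_on_add continuous_on_fst continuous_on_snd continuous_on_id)
    ultimately have "\<exists>p\<in>K. \<forall>y\<in>K. (\<lambda>(x, u). norm (F (x + u) - F x)) p \<le> (\<lambda>(x, u). norm (F (x + u) - F x)) y"
      by (rule continuous_attains_inf)
    then obtain p where p: "p \<in> K"
      and min: "\<forall>y\<in>K. (\<lambda>(x, u). norm (F (x + u) - F x)) p \<le> (\<lambda>(x, u). norm (F (x + u) - F x)) y"
      by (rule bexE)
    obtain x0 u0 where p': "p = (x0, u0)"
      by (cases p)
    define d where "d = norm (F (x0 + u0) - F x0)"
    have u0: "norm u0 = e / 2"
      using p by (simp add: K_def p')
    have "F (x0 + u0) \<noteq> F x0"
    proof
      assume "F (x0 + u0) = F x0"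
      moreover have "x0 + u0 \<in> ball x0 e" "x0 \<in> ball x0 e"
        using u0 e(1) by (simp_all add: dist_norm)
      ultimately have "x0 + u0 = x0"
        using inj[of x0] unfolding inj_on_def by blast
      then show False
        using u0 e(1) by simp
    qed
    then have "0 < d"
      by (simp add: d_def)
    moreover have "d \<le> norm (F (x + u) - F x)" if u: "norm u = e / 2" for x u
    proof -
      obtain k where k: "k \<in> int_lattice" "x + k \<in> unit_square"
        using ex_lattice_translate_unit_square[of x] by (rule bexE)
      have "(x + k, u) \<in> K"
        using k u unfolding K_def by simp
      then have "d \<le> norm (F (x + k + u) - F (x + k))"
        using bspec[OF min] by (fastforce simp: d_def p')
      also have "F (x + k + u) - F (x + k) = F (x + u) - F x"
        using eqv[OF k(1), of "x + u"] eqv[OF k(1), of x] by (simp add: ac_simps)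
      finally show ?thesis .
    qed
    ultimately show thesis
      by (rule that)
  qed
  have "ball (F x) d \<subseteq> F ` ball x (e / 2)" for x
  proof (rule ball_subset_open_map_image)
    show "continuous_on (closure (ball x (e / 2))) F"
      using cont continuous_on_subset by blast
    have "inj_on F (ball x (e / 2))"
      using inj[of x] e(1) by (rule_tac inj_on_subset) auto
    then show "open (F ` interior (ball x (e / 2)))"
      using cont continuous_on_subset by (simp add: interior_open) (blast intro: invariance_of_domain)
    show "d \<le> norm (F z - F x)" if "z \<in> frontier (ball x (e / 2))" for z
      using d(2)[of "z - x" x] that e(1) by (simp add: frontier_ball dist_norm norm_minus_commute)
  qed (use e(1) d(1) in auto)
  then show ?thesis
    using covering_space_if_uniformly_locally_injective[OF cont e(1) d(1) inj]
      covering_space_euclidean_imp_bij by blast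
qed

text \<open>The product is the group law of the torus: \<open>f\<close> differs from
  \<open>g\<close> by a factor that has a real logarithm \<open>P\<close>, and shrinking
  \<open>P\<close> to zero is the homotopy.\<close>

lemma homotopic_with_canon_torusI:
  assumes P: "continuous_on torus P" and g: "continuous_on torus g" "g ` torus \<subseteq> torus"
    and f: "\<And>z. z \<in> torus \<Longrightarrow>
      f z = (fst (torus_proj (P z)) * fst (g z), snd (torus_proj (P z)) * snd (g z))"
  shows "homotopic_with_canon (\<lambda>_. True) torus torus f g"
proof -
  define h where "h = (\<lambda>(t, z). (fst (torus_proj ((1 - t) *\<^sub>R P z)) * fst (g z),
      snd (torus_proj ((1 - t) *\<^sub>R P z)) * snd (g z)))"
  have "continuous_on ({0..1} \<times> torus) (\<lambda>p. (1 - fst p) *\<^sub>R P (snd p))"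
    by (intro continuous_intros continuous_on_compose2[OF P]) auto
  then have "continuous_on ({0..1} \<times> torus) (\<lambda>p. torus_proj ((1 - fst p) *\<^sub>R P (snd p)))"
    by (rule continuous_on_compose2[OF continuous_on_torus_proj[of UNIV]]) simp
  moreover have "continuous_on ({0..1} \<times> torus) (\<lambda>p. g (snd p))"
    by (rule continuous_on_compose2[OF g(1) continuous_on_snd[OF continuous_on_id]]) auto
  ultimately have "continuous_on ({0..1} \<times> torus) h"
    unfolding h_def split_def by (intro continuous_intros)
  moreover have "h (t, z) \<in> torus" if z: "z \<in> torus" for t z
  proof -
    have "g z \<in> torus" "torus_proj ((1 - t) *\<^sub>R P z) \<in> torus"
      using g(2) z torus_proj_mem by auto
    then show ?thesis
      by (auto simp: h_def torus_def norm_mult split: prod.splits)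
  qed
  ultimately have "continuous_map (prod_topology (top_of_set {0..1}) (top_of_set torus)) (top_of_set torus) h"
    by (auto simp: prod_topology_subtopology_eu)
  moreover have "h (0, z) = f z" "h (1, z) = g z" if "z \<in> torus" for z
    using f[OF that] by (simp_all add: h_def torus_proj_def zero_prod_def)
  ultimately show ?thesis
    by (subst homotopic_with) (auto intro!: exI[of _ h])
qed

text \<open>Any choice of representative gives the same value, and continuity holds because
  \<open>torus_proj\<close> maps open periodic sets to relatively open ones.\<close>

lemma continuous_on_torus_descend:
  fixes Q :: "real \<times> real \<Rightarrow> 'a::topological_space"
  assumes "continuous_on UNIV Q" "\<And>x k. k \<in> int_lattice \<Longrightarrow> Q (x + k) = Q x"
  shows "\<exists>P. continuous_on torus P \<and> (\<forall>x. P (torus_proj x) = Q x)"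
proof -
  define P where "P = (\<lambda>z. Q (SOME x. torus_proj x = z))"
  have P: "P (torus_proj x) = Q x" for x
  proof -
    define y where "y = (SOME y. torus_proj y = torus_proj x)"
    have "torus_proj y = torus_proj x"
      unfolding y_def by (rule someI[of _ x]) (rule refl)
    then have "Q (x + (y - x)) = Q x"
      by (intro assms(2)) (simp add: torus_proj_eq_iff)
    then show ?thesis
      by (simp add: P_def y_def)
  qed
  have "openin (top_of_set torus) (torus \<inter> P -` B)" if "open B" for B
  proof -
    have "torus \<inter> P -` B = torus_proj ` (Q -` B)"
    proof (rule subset_antisym)
      show "torus \<inter> P -` B \<subseteq> torus_proj ` (Q -` B)"
      proof
        fix z assume z: "z \<in> torus \<inter> P -` B"
        then have "z \<in> torus"
          by simp
        then obtain x where x: "z = torus_proj x"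
          by (rule torusE)
        moreover have "x \<in> Q -` B"
          using z by (simp add: x P)
        ultimately show "z \<in> torus_proj ` (Q -` B)"
          by (rule image_eqI)
      qed
      show "torus_proj ` (Q -` B) \<subseteq> torus \<inter> P -` B"
        by (simp add: image_subset_iff torus_proj_mem P)
    qed
    moreover have "open (Q -` B)"
      using assms(1) that by (simp add: open_vimage)
    moreover have "periodic (Q -` B)"
      using assms(2) by (simp add: periodic_def)
    ultimately show ?thesis
      using openin_torus_proj_image by simp
  qed
  then have "continuous_on torus P"
    by (simp add: continuous_on_open_gen continuous_openin_preimage_eq)
  then show ?thesis
    using P by blast
qed

section \<open>Integer matrices as linear lifts of linear toral maps\<close>

definition int_linear :: "int ^ 2 ^ 2 \<Rightarrow> real \<times> real \<Rightarrow> real \<times> real" where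
  "int_linear A = (\<lambda>(s, t).
     (of_int (A $ 1 $ 1) * s + of_int (A $ 1 $ 2) * t, of_int (A $ 2 $ 1) * s + of_int (A $ 2 $ 2) * t))"

lemma linear_int_linear: "linear (int_linear A)"
  by (rule linearI) (auto simp: int_linear_def algebra_simps split: prod.splits)

lemma int_linear_lattice: "k \<in> int_lattice \<Longrightarrow> int_linear A k \<in> int_lattice"
  by (auto simp: int_linear_def int_lattice_def)

lemma linear_toral_map_proj: "linear_toral_map A (torus_proj x) = torus_proj (int_linear A x)"
  by (cases x) (simp add: linear_toral_map_def torus_proj_def int_linear_def cis_power_int cis_mult algebra_simps)

lemma continuous_on_linear_toral_map: "continuous_on torus (linear_toral_map A)"
  unfolding linear_toral_map_def split_def
  by (intro continuous_intros) (auto simp: torus_def)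

text \<open>For zero determinant the columns of the adjugate lie in the kernel, so they vanish; then
  the matrix is zero and kills everything.\<close>

lemma det_nonzero_if_lattice_injective:
  assumes inj: "\<And>k. k \<in> int_lattice \<Longrightarrow> int_linear A k = 0 \<Longrightarrow> k = 0"
  shows "det A \<noteq> 0"
proof
  assume det: "det A = 0"
  define a b c d where abcd: "a = A $ 1 $ 1" "b = A $ 1 $ 2" "c = A $ 2 $ 1" "d = A $ 2 $ 2"
  have L: "int_linear A (of_int s, of_int t) = (of_int (a * s + b * t), of_int (c * s + d * t))" for s t
    by (simp add: int_linear_def abcd)
  have zero: "s = 0 \<and> t = 0" if "a * s + b * t = 0" "c * s + d * t = 0" for s t
    using inj[of "(of_int s, of_int t)"] L[of s t] that
    by (simp add: int_lattice_def zero_prod_def)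
  have "a * d = b * c"
    using det by (simp add: det_2 abcd)
  then have "d = 0 \<and> - c = 0" "- b = 0 \<and> a = 0"
    by (intro zero; simp add: algebra_simps)+
  then show False
    using zero[of 1 0] by simp
qed

lemma eigenvector_real_matrix_of_int:
  assumes "int_linear A v = c *\<^sub>R v"
  shows "real_matrix_of_int A *v vector [fst v, snd v] = c *\<^sub>R vector [fst v, snd v]"
  using assms by (cases v)
    (simp add: vec_eq_iff forall_2 matrix_vector_mult_def sum_2 real_matrix_of_int_def int_linear_def)

section \<open>From a toral endomorphism to its lift\<close>

lemma toral_endomorphism_continuous:
  assumes "toral_endomorphism f"
  shows "continuous_on torus f"
  unfolding continuous_on_eq_continuous_within
proof
  fix x assume x: "x \<in> torus"
  then obtain U g where U: "openin (top_of_set torus) U" "x \<in> U" "homeomorphism U (f ` U) f g"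
    using assms unfolding toral_endomorphism_def by blast
  then obtain T where T: "open T" "U = torus \<inter> T"
    by (auto simp: openin_open)
  have "at x within torus = at x within U"
    by (rule at_within_nhd[of x T]) (use T U in auto)
  moreover have "continuous (at x within U) f"
    using U by (meson continuous_on_eq_continuous_within homeomorphism_cont1)
  ultimately show "continuous (at x within torus) f"
    by simp
qed

text \<open>For fixed \<open>k\<close> the difference \<open>F (x + k) - F x\<close> is continuous
  in \<open>x\<close> with values in a discrete set, hence constant. The columns of \<open>A\<close>
  are its values for the two unit vectors.\<close>

lemma equivariant_lift_exists:
  assumes f: "continuous_on torus f" "f ` torus \<subseteq> torus"
  shows "\<exists>F A. continuous_on UNIV F \<and> (\<forall>x. torus_proj (F x) = f (torus_proj x)) \<and>
    (\<forall>x. \<forall>k\<in>int_lattice. F (x + k) = F x + int_linear A k)"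
proof -
  have "continuous_on UNIV (\<lambda>x. f (torus_proj x))"
    by (rule continuous_on_compose2[OF f(1) continuous_on_torus_proj]) (use torus_proj_mem in auto)
  moreover have "f (torus_proj x) \<in> torus" for x
    using f(2) torus_proj_mem by blast
  ultimately obtain F where F: "continuous_on UNIV F" "\<And>x. torus_proj (F x) = f (torus_proj x)"
    using torus_valued_lift[of "\<lambda>x. f (torus_proj x)"] by blast
  have const: "F (x + k) - F x = F k - F 0" and lat: "F (x + k) - F x \<in> int_lattice"
    if k: "k \<in> int_lattice" for x k
  proof -
    have *: "F (x + k) - F x \<in> int_lattice" for x
      using torus_proj_add_lattice[OF k] by (simp add: F(2) flip: torus_proj_eq_iff)
    then show "F (x + k) - F x \<in> int_lattice" .
    have "continuous_on UNIV (\<lambda>x. F (x + k) - F x)"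
      by (intro continuous_on_diff F(1) continuous_on_compose2[OF F(1)] continuous_intros) auto
    from continuous_lattice_valued_constant[OF this *, of x 0]
    show "F (x + k) - F x = F k - F 0"
      by simp
  qed
  have e: "(1, 0) \<in> int_lattice" "(0, 1) \<in> int_lattice"
    by (auto simp: int_lattice_def)
  obtain a c :: int where ac: "F (1, 0) - F 0 = (of_int a, of_int c)"
    using lat[OF e(1), of 0] by (auto elim: int_latticeE)
  obtain b d :: int where bd: "F (0, 1) - F 0 = (of_int b, of_int d)"
    using lat[OF e(2), of 0] by (auto elim: int_latticeE)
  define A :: "int ^ 2 ^ 2" where "A = vector [vector [a, b], vector [c, d]]"
  have "F (x + k) = F x + int_linear A k" if k: "k \<in> int_lattice" for x k
  proof -
    obtain r s where rs: "k = (of_int r, of_int s)"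
      using k by (rule int_latticeE)
    have s1: "F (x + (1, 0)) = F x + (of_int a, of_int c)" for x
      using const[OF e(1), of x] ac by (simp add: algebra_simps)
    have s2: "F (x + (0, 1)) = F x + (of_int b, of_int d)" for x
      using const[OF e(2), of x] bd by (simp add: algebra_simps)
    have "x + k = (x + of_int r *\<^sub>R (1, 0)) + of_int s *\<^sub>R (0, 1)"
      by (simp add: rs add.assoc)
    then have "F (x + k) = F x + of_int r *\<^sub>R (of_int a, of_int c) + of_int s *\<^sub>R (of_int b, of_int d)"
      by (simp only: equivariant_scale_int[of F, OF s1] equivariant_scale_int[of F, OF s2])
    then show ?thesis
      by (simp add: rs int_linear_def A_def algebra_simps)
  qed
  then show ?thesis
    using F by blast
qed

lemma lift_locally_injective:
  assumes f: "toral_endomorphism f" and F: "\<And>x. torus_proj (F x) = f (torus_proj x)"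
  shows "\<exists>r>0. inj_on F (ball x r)"
proof -
  obtain U g where U: "openin (top_of_set torus) U" "torus_proj x \<in> U" "homeomorphism U (f ` U) f g"
    using f torus_proj_mem[of x] unfolding toral_endomorphism_def by blast
  then obtain T where T: "open T" "U = torus \<inter> T"
    by (auto simp: openin_open)
  have "open (torus_proj -` T)"
    using T(1) continuous_on_torus_proj by (simp add: open_vimage)
  moreover have "x \<in> torus_proj -` T"
    using U(2) T(2) by simp
  ultimately obtain e where e: "0 < e" "ball x e \<subseteq> torus_proj -` T"
    using open_contains_ball by blast
  \<comment> \<open>Radius \<open>1 / 2\<close> makes \<open>torus_proj\<close> injective: two
    points of the ball are less than 1 apart, so a lattice difference is zero.\<close>
  have "inj_on F (ball x (min e (1 / 2)))"
  proof (rule inj_onI)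
    fix a b assume ab: "a \<in> ball x (min e (1 / 2))" "b \<in> ball x (min e (1 / 2))" and eq: "F a = F b"
    have "torus_proj a \<in> U" "torus_proj b \<in> U"
      using ab e(2) T(2) torus_proj_mem by auto
    moreover have "f (torus_proj a) = f (torus_proj b)"
      using eq F by metis
    ultimately have "torus_proj a = torus_proj b"
      using U(3) by (metis homeomorphism_apply1)
    then have lat: "a - b \<in> int_lattice"
      by (simp add: torus_proj_eq_iff)
    have "norm (a - b) < 1"
      using ab dist_triangle_half_r[of x a 1 b] by (simp add: dist_norm)
    moreover obtain p q where pq: "a - b = (p, q)"
      by (cases "a - b")
    ultimately have "\<bar>p\<bar> < 1" "\<bar>q\<bar> < 1"
      using norm_fst_le[of p q] norm_snd_le[of q p] by simp_all
    then have "p = 0" "q = 0"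
      using lat Ints_nonzero_abs_ge1[of p] Ints_nonzero_abs_ge1[of q]
      by (auto simp: int_lattice_def pq)
    then show "a = b"
      using pq by (simp flip: zero_prod_def)
  qed
  then show ?thesis
    using e(1) by (intro exI[of _ "min e (1 / 2)"]) auto
qed

lemma lift_preserving:
  assumes f: "continuous_on torus f" "f ` torus \<subseteq> torus" "area_preserving f"
    and F: "\<And>x. torus_proj (F x) = f (torus_proj x)" and S: "open S" "periodic S"
  shows "emeasure lborel (F -` S \<inter> unit_square) = emeasure lborel (S \<inter> unit_square)"
proof -
  define B where "B = torus_proj ` S"
  have B: "openin (top_of_set torus) B"
    unfolding B_def by (rule openin_torus_proj_image[OF S])
  have open_sets: "C \<in> sets torus_measure" if "openin (top_of_set torus) C" for C
  proof -
    obtain T where "open T" "C = torus \<inter> T"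
      using \<open>openin (top_of_set torus) C\<close> by (auto simp: openin_open)
    then show ?thesis
      by (auto simp: sets_torus_measure sets_restrict_space)
  qed
  have "openin (top_of_set torus) (torus \<inter> f -` B)"
    using f(1,2) B by (intro continuous_openin_preimage[of torus f torus]) auto
  then have fB: "f -` B \<inter> torus \<in> sets torus_measure"
    using open_sets by (simp add: Int_commute)
  have piB: "torus_proj -` B = S"
    unfolding B_def by (rule periodic_vimage_image[OF S(2)])
  have "torus_proj -` (f -` B \<inter> torus) = F -` S"
  proof -
    have "torus_proj x \<in> f -` B \<inter> torus \<longleftrightarrow> F x \<in> S" for x
      using F[of x] torus_proj_mem[of x] piB by (metis IntE IntI vimage_eq)
    then show ?thesis
      by blast
  qed
  then have "emeasure lborel (F -` S \<inter> unit_square) = emeasure torus_measure (f -` B \<inter> torus)"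
    by (simp add: emeasure_torus_measure[OF fB])
  also have "\<dots> = emeasure torus_measure B"
    using f(3) open_sets[OF B] by (simp add: area_preserving_def space_torus_measure)
  also have "\<dots> = emeasure lborel (S \<inter> unit_square)"
    by (simp add: emeasure_torus_measure[OF open_sets[OF B]] piB)
  finally show ?thesis .
qed

theorem theorem1:
  fixes f :: "complex \<times> complex \<Rightarrow> complex \<times> complex"
  assumes "toral_endomorphism f"
    and "area_preserving f"
    and "\<forall>x\<in>torus. toral_degree f x \<ge> 2"
    and "\<not> toral_transitive f"
  shows "\<exists>A :: int ^ 2 ^ 2. det A \<noteq> 0 \<and>
           homotopic_with_canon (\<lambda>_. True) torus torus f (linear_toral_map A) \<and>
           (\<exists>(l::real) v. \<bar>l\<bar> = 1 \<and> v \<noteq> 0 \<and> real_matrix_of_int A *v v = l *\<^sub>R v)"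
proof -
  have cont: "continuous_on torus f" and im: "f ` torus \<subseteq> torus"
    using assms(1) toral_endomorphism_continuous by (auto simp: toral_endomorphism_def)
  obtain F A where F: "continuous_on UNIV F" "\<And>x. torus_proj (F x) = f (torus_proj x)"
    "\<And>x k. k \<in> int_lattice \<Longrightarrow> F (x + k) = F x + int_linear A k"
    using equivariant_lift_exists[OF cont im] by blast
  have bij: "bij F"
    using F(1,3) lift_locally_injective[OF assms(1) F(2)] by (rule equivariant_locally_injective_imp_bij)
  interpret torus_lift F "int_linear A"
  proof (rule torus_lift.intro)
    show "int_linear A ` int_lattice \<subseteq> int_lattice"
      using int_linear_lattice by blast
    \<comment> \<open>If \<open>A\<close> were onto the lattice, lifts of two points in one fibre
      would have images differing by some \<open>A k\<close>, and injectivity of \<open>F\<close>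
      would make the lifts differ by \<open>k\<close>: fibres would have at most one point.\<close>
    show "\<not> int_lattice \<subseteq> int_linear A ` int_lattice"
    proof
      assume surj: "int_lattice \<subseteq> int_linear A ` int_lattice"
      obtain p where p: "p \<in> torus"
        using torus_proj_mem by blast
      define D where "D = {y \<in> torus. f y = p}"
      have "card D \<ge> 2"
        using assms(3) p by (simp add: D_def toral_degree_def)
      moreover have "y = z" if yz: "y \<in> D" "z \<in> D" for y z
      proof -
        have "y \<in> torus" "z \<in> torus"
          using yz by (auto simp: D_def)
        then obtain a b where ab: "y = torus_proj a" "z = torus_proj b"
          using torusE by metis
        then have "torus_proj (F a) = torus_proj (F b)"
          using yz by (simp add: F(2) D_def)
        then have "F a - F b \<in> int_lattice"
          by (simp add: torus_proj_eq_iff)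
        then obtain k where k: "k \<in> int_lattice" "F a - F b = int_linear A k"
          using surj by blast
        then have "F a = F (b + k)"
          by (simp add: F(3) algebra_simps)
        then have "a = b + k"
          using bij by (meson bij_is_inj injD)
        then show ?thesis
          using ab torus_proj_add_lattice[OF k(1)] by simp
      qed
      \<comment> \<open>For an infinite set \<open>card\<close> is 0, so the bound holds in that
        case too.\<close>
      then have "card D \<le> Suc 0"
        by (metis card.infinite card_le_Suc0_iff_eq le0)
      ultimately show False
        by simp
    qed
  qed (fact F(1) bij linear_int_linear F(3) lift_preserving[OF cont im assms(2) F(2)])+
  have "det A \<noteq> 0"
  proof (rule det_nonzero_if_lattice_injective)
    fix k assume k: "k \<in> int_lattice" "int_linear A k = 0"
    then have "F (0 + k) = F 0"
      using F(3)[of k 0] by simp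
    then show "k = 0"
      using bij by (metis add_0 bij_is_inj injD)
  qed
  moreover have "homotopic_with_canon (\<lambda>_. True) torus torus f (linear_toral_map A)"
  proof -
    have "continuous_on UNIV (\<lambda>x. F x - int_linear A x)"
      using F(1) linear_continuous_on[of "int_linear A"] linear_int_linear
      by (intro continuous_on_diff) (auto simp: linear_conv_bounded_linear)
    moreover have "F (x + k) - int_linear A (x + k) = F x - int_linear A x" if "k \<in> int_lattice" for x k
      using F(3)[OF that] linear_add[OF linear_int_linear] by simp
    ultimately obtain P where P: "continuous_on torus P" "\<And>x. P (torus_proj x) = F x - int_linear A x"
      using continuous_on_torus_descend[of "\<lambda>x. F x - int_linear A x"] by blast
    show ?thesis
    proof (rule homotopic_with_canon_torusI[OF P(1) continuous_on_linear_toral_map])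
      show "linear_toral_map A ` torus \<subseteq> torus"
        using torusE linear_toral_map_proj torus_proj_mem by (metis image_subsetI)
      fix z assume "z \<in> torus"
      then obtain x where x: "z = torus_proj x"
        by (rule torusE)
      have "f z = torus_proj ((F x - int_linear A x) + int_linear A x)"
        by (simp add: x F(2))
      then show "f z = (fst (torus_proj (P z)) * fst (linear_toral_map A z),
          snd (torus_proj (P z)) * snd (linear_toral_map A z))"
        unfolding torus_proj_add by (simp add: x P(2) linear_toral_map_proj)
    qed
  qed
  moreover have "\<exists>(l::real) v. \<bar>l\<bar> = 1 \<and> v \<noteq> 0 \<and> real_matrix_of_int A *v v = l *\<^sub>R v"
  proof -
    \<comment> \<open>The projection is continuous and onto the torus and forgets \<open>k\<close>,
      so a dense set of this form would project to a dense orbit of \<open>f\<close>.\<close>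
    have "closure {(F ^^ n) x + k | n k. k \<in> int_lattice} \<noteq> UNIV" for x
    proof
      assume dense: "closure {(F ^^ n) x + k | n k. k \<in> int_lattice} = UNIV"
      have iter: "torus_proj ((F ^^ n) x) = (f ^^ n) (torus_proj x)" for n
        by (induction n) (simp_all add: F(2))
      have "torus_proj ` {(F ^^ n) x + k | n k. k \<in> int_lattice} \<subseteq> {(f ^^ n) (torus_proj x) | n. True}"
      proof (rule image_subsetI)
        fix y assume "y \<in> {(F ^^ n) x + k | n k. k \<in> int_lattice}"
        then obtain n k where nk: "y = (F ^^ n) x + k" "k \<in> int_lattice"
          by blast
        have "torus_proj y = (f ^^ n) (torus_proj x)"
          by (simp add: nk torus_proj_add_lattice iter)
        then show "torus_proj y \<in> {(f ^^ n) (torus_proj x) | n. True}"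
          by blast
      qed
      then have "torus_proj ` UNIV \<subseteq> closure {(f ^^ n) (torus_proj x) | n. True}"
        using image_closure_subset[OF continuous_on_torus_proj closed_closure] dense closure_subset
        by (metis (no_types, lifting) subset_trans)
      then have "torus \<subseteq> closure {(f ^^ n) (torus_proj x) | n. True}"
        using torus_proj_image_unit_square by blast
      then have "toral_transitive f"
        unfolding toral_transitive_def by (rule bexI[OF _ torus_proj_mem])
      then show False
        using assms(4) by contradiction
    qed
    then obtain w c where "w \<noteq> 0" "\<bar>c\<bar> = 1" "\<And>x. w \<bullet> int_linear A x = c * (w \<bullet> x)"
      using eigenvalue_or_dense_orbit by blast
    moreover from this obtain v where v: "v \<noteq> 0" "int_linear A v = c *\<^sub>R v"
      using right_eigenvector_of_left[OF linear_int_linear] by blast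
    moreover have "(vector [fst v, snd v] :: real ^ 2) \<noteq> 0"
      using v(1) by (auto simp: vec_eq_iff forall_2 prod_eq_iff)
    ultimately show ?thesis
      using eigenvector_real_matrix_of_int[OF v(2)] by blast
  qed
  ultimately show ?thesis
    by blast
qed

end
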